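(* Let $\sigma$ be the implicit signature obtained by adding to the canonical signature $\kappa$ all implicit operations of the form $\left(a_j\circ(w_1,\ldots,w_n)^{\omega}\right)^{m^\omega}$ ($m\in\mathbb{N}$, $j\in\{1,\ldots,n\}$), where $w_1,\ldots,w_n$ are $\kappa$-terms in the letters $a_1,\ldots,a_n$ such that $\det M(w_1,\ldots,w_n)\neq 0$ and every prime dividing $\det M(w_1,\ldots,w_n)$ also divides $m$. Then the pseudovariety $\mathsf{G}_{nil}$ of all finite nilpotent groups is not completely $\sigma$-reducible.
   Context: **Pseudovarieties and pseudowords.** A pseudovariety of semigroups is a class of finite semigroups closed under subsemigroups, homomorphic images and finite direct products. $\mathsf{S}$ is the pseudovariety of all finite semigroups. For a finite alphabet $A$ and a pseudovariety $\mathsf{V}$, $\overline{\Omega}_A\mathsf{V}$ is the free pro-$\mathsf{V}$ semigroup on $A$, and $\psi_{\mathsf{V}}:\overline{\Omega}_A\mathsf{S}\to\overline{\Omega}_A\mathsf{V}$ is the continuous homomorphism that is the identity on $A$. If $\mathsf{V}$ consists of groups, $\overline{\Omega}_A\mathsf{V}$ is a profinite group, and $\psi_{\mathsf{V}}$ is extended to the monoid $(\overline{\Omega}_A\mathsf{S})^1$ (an identity $1$ adjoined as an isolated point) by $\psi_{\mathsf V}(1)=1$. $\mathsf{V}$ satisfies the pseudoidentity $u=v$ if $\psi_{\mathsf{V}}(u)=\psi_{\mathsf{V}}(v)$. **Implicit operations and signatures.** Write $\overline{\Omega}_n\mathsf{S}=\overline{\Omega}_{\{a_1,\ldots,a_n\}}\mathsf{S}$.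 Each $w\in\overline{\Omega}_n\mathsf{S}$ defines on every profinite semigroup $T$ an operation $w_T:T^n\to T$, sending $(t_1,\ldots,t_n)$ to the image of $w$ under the continuous homomorphism $\overline{\Omega}_n\mathsf{S}\to T$ with $a_i\mapsto t_i$. An implicit signature $\tau$ is a set of such operations including multiplication. Every profinite semigroup is then a $\tau$-algebra; $\Omega_A^{\tau}\mathsf{V}$ is the $\tau$-subalgebra of $\overline{\Omega}_A\mathsf{V}$ generated by $A$. A $\tau$-term is a formal expression in letters and operations of $\tau$. The canonical signature $\kappa$ consists of multiplication and $x\mapsto x^{\omega-1}=\lim_k x^{k!-1}$. **The added operations.** For $\kappa$-terms $w_1,\ldots,w_n$ in the letters $a_1,\ldots,a_n$ and a finite semigroup $T$, let $(w_1,\ldots,w_n)$ be the transformation $(t_1,\ldots,t_n)\mapsto((w_1)_T(t_1,\ldots,t_n),\ldots,(w_n)_T(t_1,\ldots,t_n))$ of $T^n$, and let $(w_1,\ldots,w_n)^\omega$ be its idempotent power under composition. Its $j$-th component is an $n$-ary implicit operation, denoted $a_j\circ(w_1,\ldots,w_n)^\omega\in\overline{\Omega}_n\mathsf{S}$. For $m\in\mathbb{N}$ ($m\geq1$), $x^{m^\omega}=\lim_{k\to\infty}x^{m^{k!}}$. $M(w_1,\ldots,w_n)$ is the $n\times n$ integer matrix whose $(i,j)$ entry is the sum of the exponents of the occurrences of $a_j$ in $w_i$, where $w_i$ is regarded as a group word by reading $x^{\omega-1}$ as $x^{-1}$. **Systems and complete reducibility.** A system of equations has disjoint finite sets $X$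 (variables) and $P$ (parameters) and finitely many equations $u_i=v_i$ ($i=1,\ldots,m$) with $u_i,v_i\in\Omega_{X\cup P}^{\sigma}\mathsf{S}$. Constraints over a finite alphabet $A$ consist of a rational language $L_x\subseteq A^*$ for each $x\in X$ and an element $w_p\in\Omega_A^\sigma\mathsf{S}$ for each $p\in P$. A solution modulo $\mathsf{V}$ is a function $\delta:X\cup P\to(\overline{\Omega}_A\mathsf{S})^1$, extended to a continuous homomorphism on $\overline{\Omega}_{X\cup P}\mathsf{S}$, such that $\delta(x)\in Cl(L_x)$ (closure in $(\overline{\Omega}_A\mathsf{S})^1$) for all $x\in X$, $\delta(p)=w_p$ for all $p\in P$, and $\mathsf{V}$ satisfies $\delta(u_i)=\delta(v_i)$ for all $i$. $\mathsf{V}$ is $\sigma$-reducible for the constrained system if, whenever it has a solution modulo $\mathsf{V}$, it has a solution modulo $\mathsf{V}$ with values in $(\Omega_A^\sigma\mathsf{S})^1$. $\mathsf{V}$ is completely $\sigma$-reducible if it is $\sigma$-reducible for every such system with every choice of constraints over every finite alphabet. *)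

theory Defs
  imports
    "HOL-Analysis.Function_Topology"
    "HOL-Algebra.Generated_Groups"
    "HOL-Computational_Algebra.Primes"
    "Jordan_Normal_Form.Determinant"
begin

section \<open>Finite semigroups\<close>

record 'a sgroup = "'a partial_object" +
  smul :: "'a \<Rightarrow> 'a \<Rightarrow> 'a"

text \<open>Classes of finite semigroups are represented by sets of finite semigroups whose elements are
  natural numbers; every finite semigroup is isomorphic to one of these.\<close>

definition fin_semigroups :: "nat sgroup set" where
  "fin_semigroups = {T. finite (carrier T) \<and> carrier T \<noteq> {} \<and>
     (\<forall>x\<in>carrier T. \<forall>y\<in>carrier T. smul T x y \<in> carrier T) \<and>
     (\<forall>x\<in>carrier T. \<forall>y\<in>carrier T. \<forall>z\<in>carrier T.
        smul T (smul T x y) z = smul T x (smul T y z))}"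

definition sg_hom :: "'a sgroup \<Rightarrow> 'b sgroup \<Rightarrow> ('a \<Rightarrow> 'b) set" where
  "sg_hom T T' = {h \<in> carrier T \<rightarrow> carrier T'.
     \<forall>x\<in>carrier T. \<forall>y\<in>carrier T. h (smul T x y) = smul T' (h x) (h y)}"

text \<open>Meaningful for positive exponents only.\<close>
definition spow :: "'a sgroup \<Rightarrow> 'a \<Rightarrow> nat \<Rightarrow> 'a" where
  "spow T x n = ((\<lambda>y. smul T y x) ^^ (n - 1)) x"

definition fin_lim :: "'a sgroup \<Rightarrow> (nat \<Rightarrow> 'a) \<Rightarrow> 'a" where
  "fin_lim T s = (THE y. limitin (discrete_topology (carrier T)) s y sequentially)"

definition omega_minus1 :: "'a sgroup \<Rightarrow> 'a \<Rightarrow> 'a" where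
  "omega_minus1 T x = fin_lim T (\<lambda>k. spow T x (fact k - 1))"

definition pow_pow_omega :: "'a sgroup \<Rightarrow> nat \<Rightarrow> 'a \<Rightarrow> 'a" where
  "pow_pow_omega T m x = fin_lim T (\<lambda>k. spow T x (m ^ fact k))"

definition sg_unit :: "'a sgroup \<Rightarrow> 'a" where
  "sg_unit T = (THE e. e \<in> carrier T \<and> (\<forall>x\<in>carrier T. smul T e x = x \<and> smul T x e = x))"

definition as_monoid :: "'a sgroup \<Rightarrow> 'a monoid" where
  "as_monoid T = \<lparr>carrier = carrier T, monoid.mult = smul T, one = sg_unit T\<rparr>"


section \<open>Nilpotent groups\<close>

primrec lower_central :: "('a, 'b) monoid_scheme \<Rightarrow> nat \<Rightarrow> 'a set" where
  "lower_central G 0 = carrier G"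
| "lower_central G (Suc c) = generate G
     {x \<otimes>\<^bsub>G\<^esub> y \<otimes>\<^bsub>G\<^esub> inv\<^bsub>G\<^esub> x \<otimes>\<^bsub>G\<^esub> inv\<^bsub>G\<^esub> y | x y. x \<in> lower_central G c \<and> y \<in> carrier G}"

definition nilpotent_group :: "('a, 'b) monoid_scheme \<Rightarrow> bool" where
  "nilpotent_group G \<longleftrightarrow> group G \<and> (\<exists>c. lower_central G c = {\<one>\<^bsub>G\<^esub>})"

definition G_nil :: "nat sgroup set" where
  "G_nil = {T \<in> fin_semigroups. nilpotent_group (as_monoid T)}"


section \<open>Free profinite semigroups\<close>

text \<open>The free pro-\<open>V\<close> semigroup on \<open>A\<close> is realised as the topological semigroup of \<open>A\<close>-ary
  implicit operations on \<open>V\<close>: an element \<open>w\<close> assigns to each \<open>T \<in> V\<close> and each valuation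
  \<open>\<phi> : A \<rightarrow> T\<close> an element \<open>w (T, \<phi>)\<close> of \<open>T\<close> (the image of \<open>w\<close> under the continuous homomorphism
  extending \<open>\<phi>\<close>), compatibly with the homomorphisms between members of \<open>V\<close>. The topology is the
  topology of pointwise convergence, each \<open>T\<close> being discrete.\<close>

type_synonym 'a pword = "nat sgroup \<times> ('a \<Rightarrow> nat) \<Rightarrow> nat"

definition valuations :: "nat sgroup set \<Rightarrow> 'a set \<Rightarrow> (nat sgroup \<times> ('a \<Rightarrow> nat)) set" where
  "valuations V A = (SIGMA T:V. A \<rightarrow>\<^sub>E carrier T)"

definition Omega :: "nat sgroup set \<Rightarrow> 'a set \<Rightarrow> 'a pword topology" where
  "Omega V A = subtopology
     (product_topology (\<lambda>(T, \<phi>). discrete_topology (carrier T)) (valuations V A))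
     {w. \<forall>T\<in>V. \<forall>T'\<in>V. \<forall>h\<in>sg_hom T T'. \<forall>\<phi>\<in>A \<rightarrow>\<^sub>E carrier T.
           h (w (T, \<phi>)) = w (T', restrict (h \<circ> \<phi>) A)}"

definition letter :: "nat sgroup set \<Rightarrow> 'a set \<Rightarrow> 'a \<Rightarrow> 'a pword" where
  "letter V A a = (\<lambda>(T, \<phi>)\<in>valuations V A. \<phi> a)"

definition pmul :: "nat sgroup set \<Rightarrow> 'a set \<Rightarrow> 'a pword \<Rightarrow> 'a pword \<Rightarrow> 'a pword" where
  "pmul V A u v = (\<lambda>(T, \<phi>)\<in>valuations V A. smul T (u (T, \<phi>)) (v (T, \<phi>)))"

text \<open>Adjoining an identity (\<open>None\<close>) as an isolated point.\<close>

definition Omega1 :: "nat sgroup set \<Rightarrow> 'a set \<Rightarrow> 'a pword option topology" where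
  "Omega1 V A = topology (\<lambda>U. U \<subseteq> insert None (Some ` topspace (Omega V A)) \<and>
                              openin (Omega V A) (Some -` U))"

lemma istopology_Omega1:
  "istopology (\<lambda>U. U \<subseteq> insert None (Some ` topspace (Omega V A)) \<and>
                   openin (Omega V A) (Some -` U))"
  by (auto simp: istopology_def vimage_Int vimage_Union)

fun pmul1 :: "nat sgroup set \<Rightarrow> 'a set \<Rightarrow> 'a pword option \<Rightarrow> 'a pword option \<Rightarrow> 'a pword option" where
  "pmul1 V A None v = v"
| "pmul1 V A u None = u"
| "pmul1 V A (Some u) (Some v) = Some (pmul V A u v)"

definition word1 :: "nat sgroup set \<Rightarrow> 'a set \<Rightarrow> 'a list \<Rightarrow> 'a pword option" where
  "word1 V A w = foldr (\<lambda>a. pmul1 V A (Some (letter V A a))) w None"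

definition cont_hom ::
  "'a topology \<Rightarrow> ('a \<Rightarrow> 'a \<Rightarrow> 'a) \<Rightarrow> 'b topology \<Rightarrow> ('b \<Rightarrow> 'b \<Rightarrow> 'b) \<Rightarrow> ('a \<Rightarrow> 'b) \<Rightarrow> bool" where
  "cont_hom X m Y m' f \<longleftrightarrow> continuous_map X Y f \<and>
     (\<forall>u\<in>topspace X. \<forall>v\<in>topspace X. f (m u v) = m' (f u) (f v))"

text \<open>The canonical homomorphism to the free pro-\<open>V\<close> semigroup, extended to the adjoined identity
  (for \<open>V\<close> consisting of groups). It maps an implicit operation to its restriction to \<open>V\<close>.\<close>

fun psi :: "nat sgroup set \<Rightarrow> 'a set \<Rightarrow> 'a pword option \<Rightarrow> 'a pword" where
  "psi V A (Some w) = restrict w (valuations V A)"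
| "psi V A None = (\<lambda>(T, \<phi>)\<in>valuations V A. sg_unit T)"


section \<open>Implicit signatures\<close>

text \<open>The letters \<open>a\<^sub>1, \<dots>, a\<^sub>n\<close> are numbered \<open>0, \<dots>, n - 1\<close>. A signature is a set of pairs \<open>(n, w)\<close>,
  with \<open>w\<close> in the free profinite semigroup on \<open>{..<n}\<close>.\<close>

type_synonym signature = "(nat \<times> nat pword) set"

text \<open>The subalgebra of the free profinite semigroup on \<open>A\<close> generated by \<open>A\<close>; the value of an
  operation \<open>w\<close> at \<open>(t\<^sub>1, \<dots>, t\<^sub>n)\<close> is the image of \<open>w\<close> under the continuous homomorphism \<open>f\<close> with
  \<open>f a\<^sub>i = t\<^sub>i\<close>.\<close>

inductive_set Omega_sig :: "signature \<Rightarrow> 'a set \<Rightarrow> 'a pword set"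
  for \<tau> :: signature and A :: "'a set" where
  gen: "a \<in> A \<Longrightarrow> letter fin_semigroups A a \<in> Omega_sig \<tau> A"
| app: "(n, w) \<in> \<tau> \<Longrightarrow>
        cont_hom (Omega fin_semigroups {..<n}) (pmul fin_semigroups {..<n})
                 (Omega fin_semigroups A) (pmul fin_semigroups A) f \<Longrightarrow>
        (\<And>i. i < n \<Longrightarrow> f (letter fin_semigroups {..<n} i) \<in> Omega_sig \<tau> A) \<Longrightarrow>
        f w \<in> Omega_sig \<tau> A"

definition implicit_op :: "nat \<Rightarrow> (nat sgroup \<Rightarrow> (nat \<Rightarrow> nat) \<Rightarrow> nat) \<Rightarrow> nat \<times> nat pword" where
  "implicit_op n F = (n, \<lambda>(T, t)\<in>valuations fin_semigroups {..<n}. F T t)"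

definition kappa :: signature where
  "kappa = {implicit_op 2 (\<lambda>T t. smul T (t 0) (t 1)), implicit_op 1 (\<lambda>T t. omega_minus1 T (t 0))}"

datatype kterm = Letter nat | Times kterm kterm | OmegaMinus1 kterm

primrec kletters :: "kterm \<Rightarrow> nat set" where
  "kletters (Letter i) = {i}"
| "kletters (Times u v) = kletters u \<union> kletters v"
| "kletters (OmegaMinus1 u) = kletters u"

primrec kval :: "'a sgroup \<Rightarrow> (nat \<Rightarrow> 'a) \<Rightarrow> kterm \<Rightarrow> 'a" where
  "kval T t (Letter i) = t i"
| "kval T t (Times u v) = smul T (kval T t u) (kval T t v)"
| "kval T t (OmegaMinus1 u) = omega_minus1 T (kval T t u)"

primrec exponent_sum :: "nat \<Rightarrow> kterm \<Rightarrow> int" where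
  "exponent_sum j (Letter i) = (if i = j then 1 else 0)"
| "exponent_sum j (Times u v) = exponent_sum j u + exponent_sum j v"
| "exponent_sum j (OmegaMinus1 u) = - exponent_sum j u"

definition exponent_matrix :: "kterm list \<Rightarrow> int mat" where
  "exponent_matrix ws =
     mat (length ws) (length ws) (\<lambda>(i, j). exponent_sum j (ws ! i))"

text \<open>The transformation of \<open>T\<^sup>n\<close> given by \<open>ws\<close>, and the idempotent power of a transformation of a
  finite set \<open>D\<close>.\<close>

definition transformation :: "'a sgroup \<Rightarrow> kterm list \<Rightarrow> (nat \<Rightarrow> 'a) \<Rightarrow> nat \<Rightarrow> 'a" where
  "transformation T ws t = (\<lambda>i\<in>{..<length ws}. kval T t (ws ! i))"

definition idempotent_power :: "'b set \<Rightarrow> ('b \<Rightarrow> 'b) \<Rightarrow> 'b \<Rightarrow> 'b" where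
  "idempotent_power D f =
     (THE g. (\<exists>k\<ge>1. g = restrict (f ^^ k) D) \<and> (\<forall>x\<in>D. g (g x) = g x))"

definition added_op :: "kterm list \<Rightarrow> nat \<Rightarrow> nat \<Rightarrow> nat \<times> nat pword" where
  "added_op ws j m = implicit_op (length ws) (\<lambda>T t. pow_pow_omega T m
     (idempotent_power ({..<length ws} \<rightarrow>\<^sub>E carrier T) (transformation T ws) t j))"

definition sigma :: signature where
  "sigma = kappa \<union> {added_op ws j m | ws j m.
     j < length ws \<and> m \<ge> 1 \<and> (\<forall>w\<in>set ws. kletters w \<subseteq> {..<length ws}) \<and>
     det (exponent_matrix ws) \<noteq> 0 \<and>
     (\<forall>p::nat. prime p \<and> int p dvd det (exponent_matrix ws) \<longrightarrow> p dvd m)}"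


section \<open>Systems of equations and complete reducibility\<close>

inductive rational :: "'a set \<Rightarrow> 'a list set \<Rightarrow> bool" for A :: "'a set" where
  empty: "rational A {}"
| single: "a \<in> A \<Longrightarrow> rational A {[a]}"
| union: "rational A K \<Longrightarrow> rational A L \<Longrightarrow> rational A (K \<union> L)"
| product: "rational A K \<Longrightarrow> rational A L \<Longrightarrow> rational A {u @ v | u v. u \<in> K \<and> v \<in> L}"
| star: "rational A L \<Longrightarrow> rational A {concat us | us. set us \<subseteq> L}"

text \<open>A constrained system consists of the alphabet \<open>A\<close>, the variables \<open>X\<close>, the parameters \<open>P\<close>, the
  set \<open>E\<close> of equations, the languages \<open>L\<close> and the parameter values \<open>w\<close>. In the definition of a
  solution, \<open>d\<close> is the continuous homomorphism extending \<open>\<delta>\<close>.\<close>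

definition solution ::
  "nat sgroup set \<Rightarrow> 'a set \<Rightarrow> 'b set \<Rightarrow> 'b set \<Rightarrow> ('b pword \<times> 'b pword) set \<Rightarrow>
   ('b \<Rightarrow> 'a list set) \<Rightarrow> ('b \<Rightarrow> 'a pword) \<Rightarrow> ('b \<Rightarrow> 'a pword option) \<Rightarrow> bool" where
  "solution V A X P E L w \<delta> \<longleftrightarrow>
     \<delta> \<in> X \<union> P \<rightarrow> topspace (Omega1 fin_semigroups A) \<and>
     (\<forall>x\<in>X. \<delta> x \<in> Omega1 fin_semigroups A closure_of (word1 fin_semigroups A ` L x)) \<and>
     (\<forall>p\<in>P. \<delta> p = Some (w p)) \<and>
     (\<exists>d. cont_hom (Omega fin_semigroups (X \<union> P)) (pmul fin_semigroups (X \<union> P))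
                   (Omega1 fin_semigroups A) (pmul1 fin_semigroups A) d \<and>
          (\<forall>y\<in>X \<union> P. d (letter fin_semigroups (X \<union> P) y) = \<delta> y) \<and>
          (\<forall>(u, v)\<in>E. psi V A (d u) = psi V A (d v)))"

definition reducible_for ::
  "signature \<Rightarrow> nat sgroup set \<Rightarrow> 'a set \<Rightarrow> 'b set \<Rightarrow> 'b set \<Rightarrow> ('b pword \<times> 'b pword) set \<Rightarrow>
   ('b \<Rightarrow> 'a list set) \<Rightarrow> ('b \<Rightarrow> 'a pword) \<Rightarrow> bool" where
  "reducible_for \<tau> V A X P E L w \<longleftrightarrow>
     ((\<exists>\<delta>. solution V A X P E L w \<delta>) \<longrightarrow>
      (\<exists>\<delta>. solution V A X P E L w \<delta> \<and>
           (\<forall>y\<in>X \<union> P. \<delta> y \<in> insert None (Some ` Omega_sig \<tau> A))))"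

text \<open>Up to renaming, finite alphabets and finite sets of variables and parameters are finite sets
  of natural numbers.\<close>

definition completely_reducible :: "signature \<Rightarrow> nat sgroup set \<Rightarrow> bool" where
  "completely_reducible \<tau> V \<longleftrightarrow>
     (\<forall>(A :: nat set) (X :: nat set) P E L w.
        finite A \<and> finite X \<and> finite P \<and> X \<inter> P = {} \<and>
        finite E \<and> E \<subseteq> Omega_sig \<tau> (X \<union> P) \<times> Omega_sig \<tau> (X \<union> P) \<and>
        (\<forall>x\<in>X. rational A (L x)) \<and> (\<forall>p\<in>P. w p \<in> Omega_sig \<tau> A) \<longrightarrow>
        reducible_for \<tau> V A X P E L w)"

end

theory Submission
  imports Defs "HOL-Number_Theory.Residues"
begin

text \<open>The obstruction lives in one letter \<open>a\<close> and one equation, \<open>x x = a\<^bsup>E\<^esup>\<close>, where \<open>a\<^bsup>E\<^esup>\<close> is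
  the limit of the powers \<open>a\<^bsup>2^(k!)\<^esup>\<close> and \<open>x\<close> ranges over the closure of \<open>a\<^sup>*\<close>. In groups, the exponents of
  one-letter pseudowords lie in the profinite integers, the product of all \<open>p\<close>-adic integers, and \<open>E\<close>
  is \<open>0\<close> at the prime \<open>2\<close> and \<open>1\<close> at every odd prime. So the equation asks for an exponent \<open>e\<close> that is
  \<open>1/2\<close> at every odd prime. The limit of \<open>2^(k! - 1)\<close> is such an exponent, and the corresponding \<open>x\<close>
  even solves the equation in all finite semigroups.

  A \<open>\<sigma>\<close>-word cannot do this, because at each single prime \<open>p\<close> its exponent is an ordinary integer
  (\<open>Omega_sig_sigma_integral\<close>). For \<open>\<kappa>\<close>-words this is clear. For an added operation there are two
  cases (\<open>sigma_operation_integral\<close>). If \<open>p\<close> divides \<open>m\<close>, the outer power makes the exponent \<open>0\<close>.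
  Otherwise \<open>p\<close> does not divide the determinant, so the matrix acts invertibly modulo every \<open>p^k\<close>; its
  idempotent power is then the identity, and the outer power changes nothing. At \<open>p = 3\<close> a \<open>\<sigma>\<close>-solution
  would therefore give an integer \<open>z\<close> with \<open>2 z \<equiv> 1\<close> modulo all powers of \<open>3\<close>, that is, \<open>2 z = 1\<close>.

  Since the cyclic groups of order \<open>3^k\<close> are nilpotent, they detect this contradiction. To evaluate in
  them a pseudoword built with arbitrary continuous homomorphisms, one needs that such a homomorphism
  is determined by the images of the letters (\<open>continuous_hom_eq_evaluation\<close>), which rests on the
  density of words (\<open>words_dense\<close>).\<close>

section \<open>Powers in finite semigroups\<close>

lemma fin_semigroups_closed:
  assumes "T \<in> fin_semigroups" "x \<in> carrier T" "y \<in> carrier T"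
  shows "smul T x y \<in> carrier T"
  using assms by (auto simp: fin_semigroups_def)

lemma fin_semigroups_assoc:
  assumes "T \<in> fin_semigroups" "x \<in> carrier T" "y \<in> carrier T" "z \<in> carrier T"
  shows "smul T (smul T x y) z = smul T x (smul T y z)"
  using assms by (auto simp: fin_semigroups_def)

lemma spow_1 [simp]: "spow T x (Suc 0) = x"
  by (simp add: spow_def)

lemma spow_Suc: "n \<ge> 1 \<Longrightarrow> spow T x (Suc n) = smul T (spow T x n) x"
  by (cases n) (auto simp: spow_def)

lemma spow_closed:
  assumes "T \<in> fin_semigroups" "x \<in> carrier T"
  shows "spow T x n \<in> carrier T"
proof -
  have "((\<lambda>y. smul T y x) ^^ k) x \<in> carrier T" for k
    by (induction k) (use assms fin_semigroups_closed in auto)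
  then show ?thesis by (simp add: spow_def)
qed

lemma spow_add:
  assumes "T \<in> fin_semigroups" "x \<in> carrier T" "m \<ge> 1" "n \<ge> 1"
  shows "spow T x (m + n) = smul T (spow T x m) (spow T x n)"
  using \<open>n \<ge> 1\<close>
proof (induction n rule: dec_induct)
  case base
  then show ?case using assms by (simp add: spow_Suc)
next
  case (step n)
  then show ?case
    using assms by (simp add: spow_Suc fin_semigroups_assoc spow_closed)
qed

lemma sg_hom_spow:
  assumes "T \<in> fin_semigroups" "h \<in> sg_hom T T'" "x \<in> carrier T"
  shows "h (spow T x n) = spow T' (h x) n"
proof -
  have "h (((\<lambda>y. smul T y x) ^^ k) x) = ((\<lambda>y. smul T' y (h x)) ^^ k) (h x)" for k
  proof (induction k)
    case (Suc k)
    have "((\<lambda>y. smul T y x) ^^ k) x \<in> carrier T"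
      using spow_closed[OF assms(1,3), of "Suc k"] by (simp add: spow_def)
    then show ?case using Suc assms by (auto simp: sg_hom_def)
  qed simp
  then show ?thesis by (simp add: spow_def)
qed

text \<open>Pigeonhole. It is stated for a general recurrence because it serves the powers of an element, the
  residues of \<open>m^n\<close> and the iterates of a transformation alike.\<close>

lemma recurrence_eventually_periodic:
  fixes a :: "nat \<Rightarrow> 'b"
  assumes "finite (range a)" and rec: "\<And>n. a (Suc n) = g (a n)"
  obtains i q where "q \<ge> 1" "\<And>n k. n \<ge> i \<Longrightarrow> a (n + k * q) = a n"
proof -
  have "\<not> inj a" using assms(1) finite_imageD infinite_UNIV_nat by blast
  then obtain i j where ij: "i < j" "a i = a j"
    unfolding inj_def by (metis nat_neq_iff)
  define q where "q = j - i"
  have step: "a (n + q) = a n" if "n \<ge> i" for n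
    using that by (induction n rule: dec_induct) (use ij in \<open>auto simp: q_def rec\<close>)
  have "a (n + k * q) = a n" if "n \<ge> i" for n k
  proof (induction k)
    case (Suc k)
    have "a (n + Suc k * q) = a ((n + k * q) + q)" by (simp add: algebra_simps)
    also have "\<dots> = a n" using step[of "n + k * q"] Suc that by simp
    finally show ?case .
  qed simp
  moreover have "q \<ge> 1" using ij by (simp add: q_def)
  ultimately show ?thesis using that by blast
qed

lemma fin_lim_eqI:
  assumes "y \<in> carrier T" "\<forall>\<^sub>F k in sequentially. s k = y"
  shows "fin_lim T s = y"
  unfolding fin_lim_def
proof (rule the_equality)
  show lim: "limitin (discrete_topology (carrier T)) s y sequentially"
    unfolding limitin_def using assms by (auto elim: eventually_mono)
  show "z = y" if "limitin (discrete_topology (carrier T)) s z sequentially" for z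
  proof -
    have "\<forall>\<^sub>F k in sequentially. s k \<in> {z}"
      using that unfolding limitin_def by auto
    from eventually_conj[OF this assms(2)] have "\<exists>k. s k \<in> {z} \<and> s k = y"
      by (rule eventually_happens'[OF sequentially_bot])
    then show ?thesis by auto
  qed
qed

text \<open>For these exponent sequences, \<open>x \<mapsto> lim x\<^bsup>s k\<^esup>\<close> is a unary implicit operation; the cases used are
  \<open>k! - 1\<close>, \<open>m^(k!)\<close> and \<open>m^(k! - 1)\<close>.\<close>

definition power_convergent :: "(nat \<Rightarrow> nat) \<Rightarrow> bool" where
  "power_convergent s \<longleftrightarrow> (\<forall>T\<in>fin_semigroups. \<forall>x\<in>carrier T.
     \<exists>y. \<forall>\<^sub>F k in sequentially. spow T x (s k) = y)"

text \<open>In a finite semigroup \<open>x^n\<close> depends, for large \<open>n\<close>, only on the residue of \<open>n\<close> modulo a period.\<close>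

lemma power_convergentI:
  assumes lim: "filterlim s at_top sequentially"
    and mods: "\<And>q::nat. q \<ge> 1 \<Longrightarrow> \<exists>r. \<forall>\<^sub>F k in sequentially. s k mod q = r"
  shows "power_convergent s"
  unfolding power_convergent_def
proof (intro ballI)
  fix T :: "nat sgroup" and x assume T: "T \<in> fin_semigroups" "x \<in> carrier T"
  have "finite (range (\<lambda>n. spow T x (Suc n)))"
    by (rule finite_subset[of _ "carrier T"]) (use T spow_closed in \<open>auto simp: fin_semigroups_def\<close>)
  then obtain i q where q: "q \<ge> 1"
    and per: "\<And>n k. n \<ge> i \<Longrightarrow> spow T x (Suc (n + k * q)) = spow T x (Suc n)"
    using recurrence_eventually_periodic[where a = "\<lambda>n. spow T x (Suc n)" and g = "\<lambda>y. smul T y x"]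
    by (metis One_nat_def Suc_eq_plus1 le_add2 spow_Suc)
  obtain r where r: "\<forall>\<^sub>F k in sequentially. s k mod q = r" using mods[OF q] by blast
  have large: "\<forall>\<^sub>F k in sequentially. s k \<ge> Suc i"
    using lim unfolding filterlim_at_top by blast
  have same: "spow T x m = spow T x n" if mn: "Suc i \<le> m" "m \<le> n" "m mod q = n mod q" for m n
  proof -
    have "q dvd n - m" using mn(2,3) by (metis mod_eq_dvd_iff_nat)
    then obtain k where "n = m + k * q"
      using mn(2) by (metis dvd_def le_add_diff_inverse mult.commute)
    then show ?thesis using per[of "m - 1" k] mn(1) by simp
  qed
  obtain k0 where k0: "\<And>k. k \<ge> k0 \<Longrightarrow> s k mod q = r \<and> s k \<ge> Suc i"
    using eventually_conj[OF r large] unfolding eventually_sequentially by blast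
  have "spow T x (s k) = spow T x (s k0)" if "k \<ge> k0" for k
    using k0[OF that] k0[of k0] same[of "s k" "s k0"] same[of "s k0" "s k"]
    by (metis nle_le order_refl)
  then show "\<exists>y. \<forall>\<^sub>F k in sequentially. spow T x (s k) = y"
    unfolding eventually_sequentially by blast
qed

lemma power_convergent_fin_lim:
  assumes "power_convergent s" "T \<in> fin_semigroups" "x \<in> carrier T"
  shows "fin_lim T (\<lambda>k. spow T x (s k)) \<in> carrier T" (is ?in)
    and "\<forall>\<^sub>F k in sequentially. spow T x (s k) = fin_lim T (\<lambda>k. spow T x (s k))" (is ?ev)
proof -
  obtain y where y: "\<forall>\<^sub>F k in sequentially. spow T x (s k) = y"
    using assms unfolding power_convergent_def by blast
  then have "y \<in> carrier T"
    using spow_closed[OF assms(2,3)] unfolding eventually_sequentially by blast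
  then have "fin_lim T (\<lambda>k. spow T x (s k)) = y" using y by (rule fin_lim_eqI)
  then show ?in ?ev using y \<open>y \<in> carrier T\<close> by auto
qed

lemma sg_hom_fin_lim_spow:
  assumes "power_convergent s" "T \<in> fin_semigroups" "T' \<in> fin_semigroups" "h \<in> sg_hom T T'"
    and "x \<in> carrier T"
  shows "h (fin_lim T (\<lambda>k. spow T x (s k))) = fin_lim T' (\<lambda>k. spow T' (h x) (s k))"
proof (rule fin_lim_eqI[symmetric])
  show "h (fin_lim T (\<lambda>k. spow T x (s k))) \<in> carrier T'"
    using assms(4) power_convergent_fin_lim(1)[OF assms(1,2,5)] by (auto simp: sg_hom_def)
  show "\<forall>\<^sub>F k in sequentially. spow T' (h x) (s k) = h (fin_lim T (\<lambda>k. spow T x (s k)))"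
    using power_convergent_fin_lim(2)[OF assms(1,2,5)]
    by eventually_elim (metis sg_hom_spow[OF assms(2,4,5)])
qed

lemma eventually_dvd_fact:
  fixes q :: nat
  assumes "q \<ge> 1" shows "\<forall>\<^sub>F k in sequentially. q dvd fact k"
  using eventually_ge_at_top[of q]
  by eventually_elim (use assms dvd_fact in auto)

lemma filterlim_fact: "filterlim (fact :: nat \<Rightarrow> nat) at_top sequentially"
  by (rule filterlim_at_top_mono[OF filterlim_ident]) (auto simp: fact_ge_self)

lemma filterlim_fact_minus_1: "filterlim (\<lambda>k. fact k - 1 :: nat) at_top sequentially"
  using filterlim_fact filterlim_minus_const_nat_at_top filterlim_compose by blast

lemma fact_minus_1_mod:
  fixes q :: nat
  assumes "q \<ge> 1"
  shows "\<exists>r. \<forall>\<^sub>F k in sequentially. (fact k - 1) mod q = r"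
proof
  show "\<forall>\<^sub>F k in sequentially. (fact k - 1) mod q = q - 1"
    using eventually_dvd_fact[OF assms]
  proof eventually_elim
    case (elim k)
    then obtain c where c: "fact k = q * c" by blast
    then have "c \<ge> 1" using fact_nonzero[of k, where 'a = nat] by (cases c) auto
    then have "fact k - 1 = (q - 1) + q * (c - 1)"
      using c assms by (cases c) auto
    also have "\<dots> mod q = q - 1" using assms by (simp only: mod_mult_self2) simp
    finally show ?case .
  qed
qed

lemma power_convergent_fact_minus_1: "power_convergent (\<lambda>k. fact k - 1)"
  by (intro power_convergentI filterlim_fact_minus_1 fact_minus_1_mod)

text \<open>The exponents \<open>m^(s k)\<close> are treated by the same principle one level higher: modulo \<open>q\<close>, the
  sequence \<open>m^n\<close> is itself eventually periodic in \<open>n\<close>. For \<open>m = 1\<close> the exponents do not tend to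
  infinity but are constant.\<close>

lemma power_convergent_power:
  assumes m: "m \<ge> 1" and lim: "filterlim s at_top sequentially"
    and mods: "\<And>q::nat. q \<ge> 1 \<Longrightarrow> \<exists>r. \<forall>\<^sub>F k in sequentially. s k mod q = r"
  shows "power_convergent (\<lambda>k. m ^ s k)"
proof (cases "m = 1")
  case True
  then show ?thesis by (auto simp: power_convergent_def)
next
  case False
  show ?thesis
  proof (rule power_convergentI)
    show "filterlim (\<lambda>k. m ^ s k) at_top sequentially"
      by (rule filterlim_at_top_mono[OF lim])
        (use False m in \<open>auto intro!: always_eventually less_imp_le_nat power_gt_expt\<close>)
  next
    fix q :: nat assume "q \<ge> 1"
    have "finite (range (\<lambda>n. m ^ n mod q))"
      by (rule finite_subset[of _ "{..<q}"]) (use \<open>q \<ge> 1\<close> in auto)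
    then obtain i p where p: "p \<ge> 1" and per: "\<And>n k. n \<ge> i \<Longrightarrow> m ^ (n + k * p) mod q = m ^ n mod q"
      using recurrence_eventually_periodic[where a = "\<lambda>n. m ^ n mod q" and g = "\<lambda>y. m * y mod q"]
      by (metis mod_mult_right_eq power_Suc)
    obtain r where r: "\<forall>\<^sub>F k in sequentially. s k mod p = r" using mods[OF p] by blast
    have same: "m ^ a mod q = m ^ b mod q" if ab: "i \<le> a" "a \<le> b" "a mod p = b mod p" for a b
    proof -
      have "p dvd b - a" using ab(2,3) by (metis mod_eq_dvd_iff_nat)
      then obtain k where "b = a + k * p"
        using ab(2) by (metis dvd_def le_add_diff_inverse mult.commute)
      then show ?thesis using per[of a k] ab(1) by simp
    qed
    have large: "\<forall>\<^sub>F k in sequentially. s k \<ge> i"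
      using lim unfolding filterlim_at_top by blast
    obtain k0 where k0: "\<And>k. k \<ge> k0 \<Longrightarrow> s k mod p = r \<and> s k \<ge> i"
      using eventually_conj[OF r large] unfolding eventually_sequentially by blast
    have "m ^ s k mod q = m ^ s k0 mod q" if "k \<ge> k0" for k
      using k0[OF that] k0[of k0] same[of "s k" "s k0"] same[of "s k0" "s k"]
      by (metis nle_le order_refl)
    then show "\<exists>r. \<forall>\<^sub>F k in sequentially. m ^ s k mod q = r"
      unfolding eventually_sequentially by blast
  qed
qed

lemma power_convergent_power_fact: "m \<ge> 1 \<Longrightarrow> power_convergent (\<lambda>k. m ^ fact k)"
proof (rule power_convergent_power)
  fix q :: nat assume "q \<ge> 1"
  show "\<exists>r. \<forall>\<^sub>F k in sequentially. fact k mod q = r"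
  proof
    show "\<forall>\<^sub>F k in sequentially. fact k mod q = 0"
      using eventually_dvd_fact[OF \<open>q \<ge> 1\<close>] by eventually_elim auto
  qed
qed (use filterlim_fact in auto)

lemma power_convergent_power_fact_minus_1: "m \<ge> 1 \<Longrightarrow> power_convergent (\<lambda>k. m ^ (fact k - 1))"
  by (intro power_convergent_power filterlim_fact_minus_1 fact_minus_1_mod)


section \<open>Idempotent powers of transformations\<close>

lemma funpow_in: "f \<in> D \<rightarrow> D \<Longrightarrow> x \<in> D \<Longrightarrow> (f ^^ k) x \<in> D"
  by (induction k) auto

lemma funpow_idempotent_mult:
  assumes "f \<in> D \<rightarrow> D" "\<forall>x\<in>D. (f ^^ k) ((f ^^ k) x) = (f ^^ k) x" "x \<in> D" "l \<ge> 1"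
  shows "(f ^^ (k * l)) x = (f ^^ k) x"
  using \<open>l \<ge> 1\<close>
proof (induction l rule: dec_induct)
  case (step l)
  have "(f ^^ (k * Suc l)) x = (f ^^ k) ((f ^^ (k * l)) x)" by (simp add: funpow_add)
  then show ?case using step assms by simp
qed simp

lemma idempotent_power_eqI:
  assumes f: "f \<in> D \<rightarrow> D" and "k \<ge> 1" and idem: "\<forall>x\<in>D. (f ^^ k) ((f ^^ k) x) = (f ^^ k) x"
  shows "idempotent_power D f = restrict (f ^^ k) D"
  unfolding idempotent_power_def
proof (rule the_equality)
  show "(\<exists>l\<ge>1. restrict (f ^^ k) D = restrict (f ^^ l) D) \<and>
        (\<forall>x\<in>D. restrict (f ^^ k) D (restrict (f ^^ k) D x) = restrict (f ^^ k) D x)"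
    using assms funpow_in[OF f] by auto
next
  fix g assume "(\<exists>l\<ge>1. g = restrict (f ^^ l) D) \<and> (\<forall>x\<in>D. g (g x) = g x)"
  then obtain l where l: "l \<ge> 1" "g = restrict (f ^^ l) D" "\<forall>x\<in>D. g (g x) = g x" by blast
  then have "\<forall>x\<in>D. (f ^^ l) ((f ^^ l) x) = (f ^^ l) x" using funpow_in[OF f] by simp
  then have "(f ^^ l) x = (f ^^ k) x" if "x \<in> D" for x
    using funpow_idempotent_mult[OF f _ that] idem l(1) \<open>k \<ge> 1\<close> by (metis mult.commute)
  then show "g = restrict (f ^^ k) D" using l(2) by (auto simp: restrict_def)
qed

lemma idempotent_power_obtain:
  assumes "finite D" and f: "f \<in> D \<rightarrow> D"
  obtains k where "k \<ge> 1" "\<forall>x\<in>D. (f ^^ k) ((f ^^ k) x) = (f ^^ k) x"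
    "idempotent_power D f = restrict (f ^^ k) D"
proof -
  let ?a = "\<lambda>n. restrict (f ^^ n) D"
  have "finite (range ?a)"
    by (rule finite_subset[of _ "D \<rightarrow>\<^sub>E D"]) (use assms funpow_in[OF f] finite_PiE in auto)
  moreover have "?a (Suc n) = restrict (f \<circ> ?a n) D" for n by (auto simp: restrict_def)
  ultimately obtain i q where q: "q \<ge> 1" "\<And>n k. n \<ge> i \<Longrightarrow> ?a (n + k * q) = ?a n"
    using recurrence_eventually_periodic[where a = ?a and g = "\<lambda>g. restrict (f \<circ> g) D"] by metis
  define k where "k = Suc i * q"
  have "i * 1 \<le> i * q" using q(1) by (rule mult_le_mono2)
  then have k: "k \<ge> i" "k \<ge> 1" using q(1) unfolding k_def mult_Suc by linarith+
  have eq: "?a (k + k) = ?a k" using q(2)[OF k(1), of "Suc i"] by (simp add: k_def)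
  have "\<forall>x\<in>D. (f ^^ k) ((f ^^ k) x) = (f ^^ k) x"
  proof
    fix x assume "x \<in> D"
    then show "(f ^^ k) ((f ^^ k) x) = (f ^^ k) x"
      using fun_cong[OF eq, of x] by (simp add: funpow_add)
  qed
  then show ?thesis using that k(2) idempotent_power_eqI[OF f] by blast
qed

lemma idempotent_power_in:
  assumes "finite D" "f \<in> D \<rightarrow> D" "x \<in> D"
  shows "idempotent_power D f x \<in> D"
  using idempotent_power_obtain[OF assms(1,2)] funpow_in[OF assms(2,3)] assms(3)
  by (metis restrict_apply')

lemma idempotent_power_inj:
  assumes "finite D" and f: "f \<in> D \<rightarrow> D" and inj: "inj_on f D" and x: "x \<in> D"
  shows "idempotent_power D f x = x"
proof -
  obtain k where k: "\<forall>x\<in>D. (f ^^ k) ((f ^^ k) x) = (f ^^ k) x"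
    "idempotent_power D f = restrict (f ^^ k) D"
    using idempotent_power_obtain[OF assms(1,2)] by metis
  have "inj_on (f ^^ n) D" for n
  proof (induction n)
    case (Suc n)
    have "inj_on f ((f ^^ n) ` D)" by (rule inj_on_subset[OF inj]) (use funpow_in[OF f] in auto)
    then show ?case using comp_inj_on[OF Suc] by (simp add: o_def)
  qed simp
  then have "(f ^^ k) x = x"
    using k(1) x funpow_in[OF f x, of k] by (meson inj_onD)
  then show ?thesis using k(2) x by simp
qed

text \<open>The exponents that make \<open>f\<close> and \<open>f'\<close> idempotent may differ; their product serves both. This is what
  makes the idempotent power of a substitution an implicit operation.\<close>

lemma idempotent_power_equivariant:
  assumes D: "finite D" "f \<in> D \<rightarrow> D" and D': "finite D'" "f' \<in> D' \<rightarrow> D'"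
    and H: "H \<in> D \<rightarrow> D'" and comm: "\<And>x. x \<in> D \<Longrightarrow> H (f x) = f' (H x)" and x: "x \<in> D"
  shows "H (idempotent_power D f x) = idempotent_power D' f' (H x)"
proof -
  obtain k where k: "k \<ge> 1" "\<forall>x\<in>D. (f ^^ k) ((f ^^ k) x) = (f ^^ k) x"
    "idempotent_power D f = restrict (f ^^ k) D"
    using idempotent_power_obtain[OF D] by metis
  obtain l where l: "l \<ge> 1" "\<forall>x\<in>D'. (f' ^^ l) ((f' ^^ l) x) = (f' ^^ l) x"
    "idempotent_power D' f' = restrict (f' ^^ l) D'"
    using idempotent_power_obtain[OF D'] by metis
  have commute: "H ((f ^^ n) x) = (f' ^^ n) (H x)" for n
    by (induction n) (use comm funpow_in[OF D(2) x] in auto)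
  have "H x \<in> D'" using H x by auto
  then have "(f' ^^ l) (H x) = (f' ^^ (l * k)) (H x)"
    using funpow_idempotent_mult[OF D'(2) l(2) _ k(1)] by simp
  also have "\<dots> = H ((f ^^ (k * l)) x)" by (simp add: commute mult.commute)
  also have "\<dots> = H ((f ^^ k) x)"
    using funpow_idempotent_mult[OF D(2) k(2) x l(1)] by simp
  finally show ?thesis using k(3) l(3) x \<open>H x \<in> D'\<close> by simp
qed


section \<open>The topological semigroups of implicit operations\<close>

lemma sg_hom_valuation:
  assumes "h \<in> sg_hom T T'" "\<phi> \<in> A \<rightarrow>\<^sub>E carrier T"
  shows "restrict (h \<circ> \<phi>) A \<in> A \<rightarrow>\<^sub>E carrier T'"
  using assms by (auto simp: sg_hom_def)

lemma topspace_Omega: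
  "w \<in> topspace (Omega V A) \<longleftrightarrow> w \<in> extensional (valuations V A) \<and>
     (\<forall>T\<in>V. \<forall>\<phi>\<in>A \<rightarrow>\<^sub>E carrier T. w (T, \<phi>) \<in> carrier T) \<and>
     (\<forall>T\<in>V. \<forall>T'\<in>V. \<forall>h\<in>sg_hom T T'. \<forall>\<phi>\<in>A \<rightarrow>\<^sub>E carrier T.
        h (w (T, \<phi>)) = w (T', restrict (h \<circ> \<phi>) A))"
  unfolding Omega_def topspace_subtopology topspace_product_topology
  by (auto simp: PiE_iff valuations_def Sigma_def)

lemma implicit_operation_in_topspace:
  assumes "\<And>T \<phi>. T \<in> V \<Longrightarrow> \<phi> \<in> A \<rightarrow>\<^sub>E carrier T \<Longrightarrow> F T \<phi> \<in> carrier T"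
    and "\<And>T T' h \<phi>. T \<in> V \<Longrightarrow> T' \<in> V \<Longrightarrow> h \<in> sg_hom T T' \<Longrightarrow> \<phi> \<in> A \<rightarrow>\<^sub>E carrier T \<Longrightarrow>
           h (F T \<phi>) = F T' (restrict (h \<circ> \<phi>) A)"
  shows "(\<lambda>(T, \<phi>)\<in>valuations V A. F T \<phi>) \<in> topspace (Omega V A)"
proof -
  have eval: "(\<lambda>(T, \<phi>)\<in>valuations V A. F T \<phi>) (T, \<phi>) = F T \<phi>"
    if "T \<in> V" "\<phi> \<in> A \<rightarrow>\<^sub>E carrier T" for T \<phi>
    using that by (simp add: valuations_def)
  show ?thesis
    unfolding topspace_Omega
    by (intro conjI ballI) (simp_all only: eval assms sg_hom_valuation restrict_extensional)
qed

lemma letter_in_topspace: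
  assumes "a \<in> A" shows "letter V A a \<in> topspace (Omega V A)"
  unfolding letter_def by (rule implicit_operation_in_topspace) (use assms in auto)

lemma pmul_in_topspace:
  assumes "u \<in> topspace (Omega fin_semigroups A)" "v \<in> topspace (Omega fin_semigroups A)"
  shows "pmul fin_semigroups A u v \<in> topspace (Omega fin_semigroups A)"
  unfolding pmul_def
proof (rule implicit_operation_in_topspace)
  fix T T' :: "nat sgroup" and h \<phi>
  assume T: "T \<in> fin_semigroups" "T' \<in> fin_semigroups" "h \<in> sg_hom T T'"
    and \<phi>: "\<phi> \<in> A \<rightarrow>\<^sub>E carrier T"
  have "h (u (T, \<phi>)) = u (T', restrict (h \<circ> \<phi>) A)" "h (v (T, \<phi>)) = v (T', restrict (h \<circ> \<phi>) A)"
    "u (T, \<phi>) \<in> carrier T" "v (T, \<phi>) \<in> carrier T"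
    using assms T \<phi> unfolding topspace_Omega by blast+
  then show "h (smul T (u (T, \<phi>)) (v (T, \<phi>))) =
      smul T' (u (T', restrict (h \<circ> \<phi>) A)) (v (T', restrict (h \<circ> \<phi>) A))"
    using T(3) by (simp add: sg_hom_def)
qed (use assms in \<open>auto simp: topspace_Omega intro: fin_semigroups_closed\<close>)

lemma letter_apply: "T \<in> V \<Longrightarrow> \<phi> \<in> A \<rightarrow>\<^sub>E carrier T \<Longrightarrow> letter V A a (T, \<phi>) = \<phi> a"
  by (simp add: letter_def valuations_def)

lemma pmul_apply:
  "T \<in> V \<Longrightarrow> \<phi> \<in> A \<rightarrow>\<^sub>E carrier T \<Longrightarrow> pmul V A u v (T, \<phi>) = smul T (u (T, \<phi>)) (v (T, \<phi>))"
  by (simp add: pmul_def valuations_def)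

lemma continuous_map_coordinate:
  assumes "T \<in> V" "\<phi> \<in> A \<rightarrow>\<^sub>E carrier T"
  shows "continuous_map (Omega V A) (discrete_topology (carrier T)) (\<lambda>w. w (T, \<phi>))"
proof -
  have "(T, \<phi>) \<in> valuations V A" using assms by (simp add: valuations_def)
  from continuous_map_product_projection[OF this,
      of "\<lambda>(T, \<phi>). discrete_topology (carrier T)"]
  show ?thesis unfolding Omega_def by (simp add: continuous_map_from_subtopology)
qed

text \<open>Pointwise convergence of functions with discrete values: a neighbourhood only prescribes
  finitely many coordinates.\<close>

lemma Omega_neighbourhood:
  assumes "openin (Omega V A) U" "w \<in> U"
  obtains F where "finite F" "F \<subseteq> valuations V A"
    "\<And>v. v \<in> topspace (Omega V A) \<Longrightarrow> (\<And>i. i \<in> F \<Longrightarrow> v i = w i) \<Longrightarrow> v \<in> U"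
proof -
  let ?X = "\<lambda>(T :: nat sgroup, \<phi> :: 'a \<Rightarrow> nat). discrete_topology (carrier T)"
  let ?C = "{w. \<forall>T\<in>V. \<forall>T'\<in>V. \<forall>h\<in>sg_hom T T'. \<forall>\<phi>\<in>A \<rightarrow>\<^sub>E carrier T.
      h (w (T, \<phi>)) = w (T', restrict (h \<circ> \<phi>) A)}"
  have "\<exists>N. openin (product_topology ?X (valuations V A)) N \<and> U = N \<inter> ?C"
    using assms(1) unfolding Omega_def openin_subtopology .
  then obtain N where N: "openin (product_topology ?X (valuations V A)) N" and U: "U = N \<inter> ?C"
    by (elim exE conjE)
  have C: "topspace (Omega V A) \<subseteq> ?C"
    unfolding Omega_def topspace_subtopology by (rule Int_lower2)
  have "w \<in> N" using assms(2) unfolding U by (rule IntD1)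
  have "\<exists>B. finite {i \<in> valuations V A. B i \<noteq> topspace (?X i)} \<and>
      (\<forall>i\<in>valuations V A. openin (?X i) (B i)) \<and>
      w \<in> Pi\<^sub>E (valuations V A) B \<and> Pi\<^sub>E (valuations V A) B \<subseteq> N"
    using N[unfolded openin_product_topology_alt] \<open>w \<in> N\<close> by (rule bspec)
  then obtain B where B: "finite {i \<in> valuations V A. B i \<noteq> topspace (?X i)}"
    "w \<in> Pi\<^sub>E (valuations V A) B" "Pi\<^sub>E (valuations V A) B \<subseteq> N"
    by (elim exE conjE)
  show ?thesis
  proof
    fix v assume v: "v \<in> topspace (Omega V A)"
      and vw: "\<And>i. i \<in> {i \<in> valuations V A. B i \<noteq> topspace (?X i)} \<Longrightarrow> v i = w i"
    have "v i \<in> B i" if "i \<in> valuations V A" for i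
    proof (cases "B i = topspace (?X i)")
      case True
      then show ?thesis using v that by (auto simp: topspace_Omega valuations_def)
    next
      case False
      then show ?thesis using vw[of i] B(2) that by auto
    qed
    then have "v \<in> Pi\<^sub>E (valuations V A) B" using v by (auto simp: topspace_Omega PiE_iff)
    then have "v \<in> N" using B(3) by (rule rev_subsetD)
    then show "v \<in> U" unfolding U using subsetD[OF C v] by (rule IntI)
  qed (use B(1) in auto)
qed

inductive_set words :: "'a set \<Rightarrow> 'a pword set" for A :: "'a set" where
  letter: "a \<in> A \<Longrightarrow> letter fin_semigroups A a \<in> words A"
| mult: "u \<in> words A \<Longrightarrow> v \<in> words A \<Longrightarrow> pmul fin_semigroups A u v \<in> words A"

lemma words_in_topspace: "v \<in> words A \<Longrightarrow> v \<in> topspace (Omega fin_semigroups A)"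
  by (induction rule: words.induct) (auto intro: letter_in_topspace pmul_in_topspace)

lemma pmul_assoc:
  assumes "u \<in> topspace (Omega fin_semigroups A)" "v \<in> topspace (Omega fin_semigroups A)"
    "w \<in> topspace (Omega fin_semigroups A)"
  shows "pmul fin_semigroups A (pmul fin_semigroups A u v) w =
         pmul fin_semigroups A u (pmul fin_semigroups A v w)"
  using assms unfolding pmul_def topspace_Omega
  by (auto simp: fun_eq_iff restrict_def valuations_def intro!: fin_semigroups_assoc)

text \<open>Finitely many valuations \<open>\<phi>\<^sub>i : A \<rightarrow> T\<^sub>i\<close> combine to one valuation in
  the subsemigroup of \<open>\<Prod>T\<^sub>i\<close> generated by the diagonal images of the letters. There the value of
  an implicit operation is, like every other element, the value of a word, and compatibility with
  the projections carries this equality back to all the \<open>T\<^sub>i\<close>.\<close>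

lemma words_dense:
  assumes "A \<noteq> {}" and w: "w \<in> topspace (Omega fin_semigroups A)"
    and F: "finite F" "F \<subseteq> valuations fin_semigroups A"
  obtains v where "v \<in> words A" "\<And>i. i \<in> F \<Longrightarrow> v i = w i"
proof -
  have FD: "T \<in> fin_semigroups" "\<phi> \<in> A \<rightarrow>\<^sub>E carrier T" if "(T, \<phi>) \<in> F" for T \<phi>
    using F(2) that by (auto simp: valuations_def)
  have coord: "v (T, \<phi>) \<in> carrier T" if "v \<in> words A" "(T, \<phi>) \<in> F" for v T \<phi>
    using words_in_topspace[OF that(1)] FD[OF that(2)] unfolding topspace_Omega by blast
  define W where "W = (\<lambda>v. restrict v F) ` words A"
  have "W \<subseteq> Pi\<^sub>E F (\<lambda>i. carrier (fst i))" using coord by (auto simp: W_def)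
  moreover have "finite (Pi\<^sub>E F (\<lambda>i. carrier (fst i)))"
    using F(1) FD by (intro finite_PiE) (auto simp: fin_semigroups_def)
  ultimately have "finite W" by (rule finite_subset)
  then obtain e :: "('a pword) \<Rightarrow> nat" where e: "inj_on e W"
    using finite_imp_inj_to_nat_seg by blast
  define c where "c v = e (restrict v F)" for v
  define d where "d = inv_into W e"
  have d: "d (c v) = restrict v F" if "v \<in> words A" for v
    using that e by (simp add: c_def d_def W_def)
  define P :: "nat sgroup" where
    "P = \<lparr>carrier = c ` words A, smul = (\<lambda>x y. e (\<lambda>i\<in>F. smul (fst i) (d x i) (d y i)))\<rparr>"
  have mul: "smul P (c u) (c v) = c (pmul fin_semigroups A u v)"
    if "u \<in> words A" "v \<in> words A" for u v
    using that FD by (auto simp: P_def c_def d[unfolded c_def] pmul_apply intro!: arg_cong[where f = e])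
  have carrier_P: "carrier P = c ` words A" by (simp add: P_def)
  have P: "P \<in> fin_semigroups"
    unfolding fin_semigroups_def mem_Collect_eq
  proof (intro conjI)
    have "c ` words A = e ` W" by (auto simp: c_def W_def)
    then show "finite (carrier P)" using \<open>finite W\<close> by (simp add: carrier_P)
    obtain a where "a \<in> A" using \<open>A \<noteq> {}\<close> by blast
    from words.letter[OF this] show "carrier P \<noteq> {}" by (auto simp: carrier_P)
    show "\<forall>x\<in>carrier P. \<forall>y\<in>carrier P. smul P x y \<in> carrier P"
      by (auto simp: carrier_P mul intro: words.mult)
    show "\<forall>x\<in>carrier P. \<forall>y\<in>carrier P. \<forall>z\<in>carrier P.
        smul P (smul P x y) z = smul P x (smul P y z)"
      by (auto simp: carrier_P mul words.mult pmul_assoc words_in_topspace)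
  qed
  define \<phi>' where "\<phi>' = (\<lambda>a\<in>A. c (letter fin_semigroups A a))"
  have \<phi>': "\<phi>' \<in> A \<rightarrow>\<^sub>E carrier P" by (auto simp: \<phi>'_def P_def intro: words.letter)
  have "w (P, \<phi>') \<in> carrier P" using w P \<phi>' unfolding topspace_Omega by blast
  then obtain v where v: "v \<in> words A" "w (P, \<phi>') = c v" by (auto simp: P_def)
  have "v (T, \<phi>) = w (T, \<phi>)" if i: "(T, \<phi>) \<in> F" for T \<phi>
  proof -
    define \<pi> where "\<pi> x = d x (T, \<phi>)" for x
    have \<pi>c: "\<pi> (c u) = u (T, \<phi>)" if "u \<in> words A" for u
      using d[OF that] i by (simp add: \<pi>_def)
    have "\<pi> \<in> sg_hom P T"
      unfolding sg_hom_def carrier_P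
      using coord i by (auto simp: mul \<pi>c words.mult pmul_apply[OF FD[OF i]])
    then have "\<pi> (w (P, \<phi>')) = w (T, restrict (\<pi> \<circ> \<phi>') A)"
      using w P \<phi>' FD(1)[OF i] unfolding topspace_Omega by blast
    moreover have "restrict (\<pi> \<circ> \<phi>') A = \<phi>"
      using FD[OF i] by (auto simp: \<phi>'_def \<pi>c words.letter letter_apply restrict_def PiE_iff extensional_def fun_eq_iff)
    ultimately show ?thesis using v \<pi>c by simp
  qed
  then show ?thesis using that v(1) by auto
qed

text \<open>This is the uniqueness half of the universal property of the free profinite semigroup: both sides
  agree on words, words are dense, and the target is discrete.\<close>

lemma continuous_hom_eq_evaluation:
  assumes g: "cont_hom (Omega fin_semigroups A) (pmul fin_semigroups A)
                (discrete_topology (carrier T)) (smul T) g"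
    and T: "T \<in> fin_semigroups" and "A \<noteq> {}" and w: "w \<in> topspace (Omega fin_semigroups A)"
  shows "g w = w (T, \<lambda>a\<in>A. g (letter fin_semigroups A a))"
proof -
  let ?\<psi> = "\<lambda>a\<in>A. g (letter fin_semigroups A a)"
  have cont: "continuous_map (Omega fin_semigroups A) (discrete_topology (carrier T)) g"
    and hom: "\<And>u v. u \<in> topspace (Omega fin_semigroups A) \<Longrightarrow> v \<in> topspace (Omega fin_semigroups A) \<Longrightarrow>
      g (pmul fin_semigroups A u v) = smul T (g u) (g v)"
    using g by (auto simp: cont_hom_def)
  have in_T: "g u \<in> carrier T" if "u \<in> topspace (Omega fin_semigroups A)" for u
    using continuous_map_image_subset_topspace[OF cont] that by auto
  have \<psi>: "?\<psi> \<in> A \<rightarrow>\<^sub>E carrier T" using in_T[OF letter_in_topspace] by auto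
  have on_words: "g v = v (T, ?\<psi>)" if "v \<in> words A" for v
    using that
  proof induction
    case (letter a)
    then show ?case unfolding letter_apply[OF T \<psi>] by simp
  next
    case (mult u v)
    then show ?case
      by (simp only: pmul_apply[OF T \<psi>] hom[OF words_in_topspace words_in_topspace])
  qed
  let ?U = "{u \<in> topspace (Omega fin_semigroups A). g u \<in> {g w}}"
  have "openin (Omega fin_semigroups A) ?U"
    by (rule openin_continuous_map_preimage[OF cont]) (use in_T[OF w] in auto)
  moreover have "w \<in> ?U" using w by simp
  ultimately obtain F where F: "finite F" "F \<subseteq> valuations fin_semigroups A"
    and nbhd: "\<And>v. v \<in> topspace (Omega fin_semigroups A) \<Longrightarrow> (\<And>i. i \<in> F \<Longrightarrow> v i = w i) \<Longrightarrow> v \<in> ?U"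
    by (rule Omega_neighbourhood) blast
  have "finite (insert (T, ?\<psi>) F)" "insert (T, ?\<psi>) F \<subseteq> valuations fin_semigroups A"
    using F T \<psi> by (auto simp: valuations_def)
  then obtain v where v: "v \<in> words A" "\<And>i. i \<in> insert (T, ?\<psi>) F \<Longrightarrow> v i = w i"
    using words_dense[OF \<open>A \<noteq> {}\<close> w] by metis
  then have "g w = g v" using nbhd[OF words_in_topspace[OF v(1)]] by auto
  also have "\<dots> = v (T, ?\<psi>)" by (rule on_words[OF v(1)])
  also have "\<dots> = w (T, ?\<psi>)" by (rule v(2)) simp
  finally show ?thesis .
qed

text \<open>Its existence half, for free profinite targets: the continuous homomorphism extending a map
  \<open>t\<close> on letters is composition of implicit operations.\<close>

definition substitute :: "'a set \<Rightarrow> 'b set \<Rightarrow> ('a \<Rightarrow> 'b pword) \<Rightarrow> 'a pword \<Rightarrow> 'b pword" where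
  "substitute A B t w = (\<lambda>(T, \<phi>)\<in>valuations fin_semigroups B. w (T, \<lambda>a\<in>A. t a (T, \<phi>)))"

lemma substitute_apply:
  "T \<in> fin_semigroups \<Longrightarrow> \<phi> \<in> B \<rightarrow>\<^sub>E carrier T \<Longrightarrow> substitute A B t w (T, \<phi>) = w (T, \<lambda>a\<in>A. t a (T, \<phi>))"
  by (simp add: substitute_def valuations_def)

lemma substitute_letter:
  assumes t: "t \<in> A \<rightarrow> topspace (Omega fin_semigroups B)" and a: "a \<in> A"
  shows "substitute A B t (letter fin_semigroups A a) = t a"
proof -
  have ta: "t b \<in> topspace (Omega fin_semigroups B)" if "b \<in> A" for b using t that by auto
  have "(\<lambda>a\<in>A. t a (T, \<phi>)) \<in> A \<rightarrow>\<^sub>E carrier T"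
    if "T \<in> fin_semigroups" "\<phi> \<in> B \<rightarrow>\<^sub>E carrier T" for T \<phi>
    using ta that unfolding topspace_Omega by auto
  then show ?thesis
    using ta[OF a] a unfolding topspace_Omega substitute_def
    by (auto simp: fun_eq_iff restrict_def valuations_def extensional_def letter_apply[unfolded restrict_def])
qed

lemma cont_hom_substitute:
  assumes t: "t \<in> A \<rightarrow> topspace (Omega fin_semigroups B)"
  shows "cont_hom (Omega fin_semigroups A) (pmul fin_semigroups A)
    (Omega fin_semigroups B) (pmul fin_semigroups B) (substitute A B t)"
proof -
  have val: "(\<lambda>a\<in>A. t a (T, \<phi>)) \<in> A \<rightarrow>\<^sub>E carrier T"
    if "T \<in> fin_semigroups" "\<phi> \<in> B \<rightarrow>\<^sub>E carrier T" for T \<phi>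
    using t that unfolding topspace_Omega by (auto simp: Pi_iff topspace_Omega)
  have top: "substitute A B t w \<in> topspace (Omega fin_semigroups B)"
    if w: "w \<in> topspace (Omega fin_semigroups A)" for w
    unfolding substitute_def
  proof (rule implicit_operation_in_topspace)
    fix T T' :: "nat sgroup" and h \<phi>
    assume T: "T \<in> fin_semigroups" "T' \<in> fin_semigroups" "h \<in> sg_hom T T'"
      and \<phi>: "\<phi> \<in> B \<rightarrow>\<^sub>E carrier T"
    have "h (w (T, \<lambda>a\<in>A. t a (T, \<phi>))) = w (T', restrict (h \<circ> (\<lambda>a\<in>A. t a (T, \<phi>))) A)"
      using w T val[OF T(1) \<phi>] unfolding topspace_Omega by blast
    also have "restrict (h \<circ> (\<lambda>a\<in>A. t a (T, \<phi>))) A = (\<lambda>a\<in>A. t a (T', restrict (h \<circ> \<phi>) B))"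
      using t T \<phi> by (intro restrict_ext) (auto simp: Pi_iff topspace_Omega)
    finally show "h (w (T, \<lambda>a\<in>A. t a (T, \<phi>))) = w (T', \<lambda>a\<in>A. t a (T', restrict (h \<circ> \<phi>) B))" .
  qed (use w val in \<open>auto simp: topspace_Omega\<close>)
  have "continuous_map (Omega fin_semigroups A) (Omega fin_semigroups B) (substitute A B t)"
    unfolding Omega_def[of _ B]
  proof (rule continuous_map_into_subtopology)
    show "continuous_map (Omega fin_semigroups A)
      (product_topology (\<lambda>(T, \<phi>). discrete_topology (carrier T)) (valuations fin_semigroups B))
      (substitute A B t)"
      unfolding continuous_map_componentwise
    proof (intro conjI ballI)
      fix i assume "i \<in> valuations fin_semigroups B"
      then obtain T \<phi> where i: "i = (T, \<phi>)" and T: "T \<in> fin_semigroups" "\<phi> \<in> B \<rightarrow>\<^sub>E carrier T"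
        by (auto simp: valuations_def)
      show "continuous_map (Omega fin_semigroups A)
          (case i of (T, \<phi>) \<Rightarrow> discrete_topology (carrier T)) (\<lambda>w. substitute A B t w i)"
        using continuous_map_coordinate[OF T(1) val[OF T]] by (simp add: i substitute_apply T)
    qed (auto simp: substitute_def)
  qed (use top in \<open>auto simp: Omega_def[of _ B]\<close>)
  moreover have "substitute A B t (pmul fin_semigroups A u v) =
      pmul fin_semigroups B (substitute A B t u) (substitute A B t v)" for u v
    using val by (auto simp: substitute_def pmul_def fun_eq_iff restrict_def valuations_def)
  ultimately show ?thesis by (simp add: cont_hom_def)
qed

lemma openin_Omega1:
  "openin (Omega1 V A) U \<longleftrightarrow>
     U \<subseteq> insert None (Some ` topspace (Omega V A)) \<and> openin (Omega V A) (Some -` U)"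
  unfolding Omega1_def by (simp add: topology_inverse' istopology_Omega1)

lemma topspace_Omega1: "topspace (Omega1 V A) = insert None (Some ` topspace (Omega V A))"
proof
  show "topspace (Omega1 V A) \<subseteq> insert None (Some ` topspace (Omega V A))"
    using openin_topspace[of "Omega1 V A"] unfolding openin_Omega1 by blast
  have "Some -` insert None (Some ` topspace (Omega V A)) = topspace (Omega V A)" by auto
  then have "openin (Omega1 V A) (insert None (Some ` topspace (Omega V A)))"
    by (simp add: openin_Omega1)
  then show "insert None (Some ` topspace (Omega V A)) \<subseteq> topspace (Omega1 V A)"
    by (rule openin_subset)
qed

lemma continuous_map_Some: "continuous_map (Omega V A) (Omega1 V A) Some"
  unfolding continuous_map_def
proof (intro conjI allI impI)
  fix U assume "openin (Omega1 V A) U"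
  then have "openin (Omega V A) (topspace (Omega V A) \<inter> Some -` U)"
    by (simp add: openin_Omega1 openin_Int)
  then show "openin (Omega V A) {x \<in> topspace (Omega V A). Some x \<in> U}"
    by (simp add: vimage_def Int_def)
qed (auto simp: topspace_Omega1)

lemma continuous_map_from_Omega1:
  assumes f: "continuous_map (Omega V A) Y (\<lambda>w. f (Some w))" and "f None \<in> topspace Y"
  shows "continuous_map (Omega1 V A) Y f"
  unfolding continuous_map_def
proof (intro conjI allI impI)
  show "f \<in> topspace (Omega1 V A) \<rightarrow> topspace Y"
    using assms continuous_map_image_subset_topspace[OF f] by (auto simp: topspace_Omega1)
  fix U assume "openin Y U"
  then have "openin (Omega V A) {w \<in> topspace (Omega V A). f (Some w) \<in> U}"
    by (rule openin_continuous_map_preimage[OF f])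
  moreover have "Some -` {x \<in> topspace (Omega1 V A). f x \<in> U} =
      {w \<in> topspace (Omega V A). f (Some w) \<in> U}" by (auto simp: topspace_Omega1)
  ultimately show "openin (Omega1 V A) {x \<in> topspace (Omega1 V A). f x \<in> U}"
    by (auto simp: openin_Omega1 topspace_Omega1)
qed

lemma word1_replicate:
  "word1 fin_semigroups A (replicate (Suc n) a) =
     Some (\<lambda>(T, \<phi>)\<in>valuations fin_semigroups A. spow T (\<phi> a) (Suc n))" if a: "a \<in> A"
proof (induction n)
  case 0
  have eq: "letter fin_semigroups A a = (\<lambda>(T, \<phi>)\<in>valuations fin_semigroups A. spow T (\<phi> a) (Suc 0))"
    by (auto simp: letter_def fun_eq_iff restrict_def)
  show ?case
    by (simp only: word1_def replicate.simps foldr_Cons foldr_Nil o_apply id_apply pmul1.simps eq)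
next
  case (Suc n)
  have "spow T (\<phi> a) (Suc (Suc n)) = smul T (\<phi> a) (spow T (\<phi> a) (Suc n))"
    if "(T, \<phi>) \<in> valuations fin_semigroups A" for T \<phi>
    using that a spow_add[of T "\<phi> a" 1 "Suc n"] by (auto simp: valuations_def PiE_iff)
  then show ?case
    using Suc by (auto simp: word1_def pmul_def letter_def fun_eq_iff restrict_def)
qed

definition power_limit :: "'a set \<Rightarrow> 'a \<Rightarrow> (nat \<Rightarrow> nat) \<Rightarrow> 'a pword" where
  "power_limit A a s = (\<lambda>(T, \<phi>)\<in>valuations fin_semigroups A. fin_lim T (\<lambda>k. spow T (\<phi> a) (s k)))"

lemma power_limit_in_topspace:
  assumes "a \<in> A" "power_convergent s"
  shows "power_limit A a s \<in> topspace (Omega fin_semigroups A)"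
  unfolding power_limit_def
proof (rule implicit_operation_in_topspace)
  fix T T' :: "nat sgroup" and h \<phi>
  assume T: "T \<in> fin_semigroups" "T' \<in> fin_semigroups" "h \<in> sg_hom T T'" "\<phi> \<in> A \<rightarrow>\<^sub>E carrier T"
  then have "\<phi> a \<in> carrier T" using assms(1) by auto
  then show "h (fin_lim T (\<lambda>k. spow T (\<phi> a) (s k))) =
      fin_lim T' (\<lambda>k. spow T' (restrict (h \<circ> \<phi>) A a) (s k))"
    using sg_hom_fin_lim_spow[OF assms(2) T(1-3)] assms(1) by simp
qed (use assms in \<open>auto intro!: power_convergent_fin_lim(1)\<close>)

lemma power_limit_in_closure:
  assumes a: "a \<in> A" and s: "power_convergent s" and pos: "\<And>k. s k \<ge> 1"
  shows "Some (power_limit A a s) \<in>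
    Omega1 fin_semigroups A closure_of (word1 fin_semigroups A ` range (\<lambda>n. replicate n a))"
  unfolding in_closure_of
proof (intro conjI allI impI)
  show "Some (power_limit A a s) \<in> topspace (Omega1 fin_semigroups A)"
    using power_limit_in_topspace[OF a s] by (simp add: topspace_Omega1)
next
  fix U assume U: "Some (power_limit A a s) \<in> U \<and> openin (Omega1 fin_semigroups A) U"
  define p where "p n = (\<lambda>(T, \<phi>)\<in>valuations fin_semigroups A. spow T (\<phi> a) n)" for n
  have p: "word1 fin_semigroups A (replicate n a) = Some (p n)" if "n \<ge> 1" for n
    using word1_replicate[OF a, of "n - 1"] that by (simp add: p_def)
  have p_top: "p n \<in> topspace (Omega fin_semigroups A)" for n
    unfolding p_def
    by (rule implicit_operation_in_topspace) (use a in \<open>auto intro!: spow_closed sg_hom_spow\<close>)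
  have "openin (Omega fin_semigroups A) (Some -` U)" "power_limit A a s \<in> Some -` U"
    using U by (auto simp: openin_Omega1)
  then obtain F where F: "finite F" "F \<subseteq> valuations fin_semigroups A"
    and nbhd: "\<And>v. v \<in> topspace (Omega fin_semigroups A) \<Longrightarrow>
      (\<And>i. i \<in> F \<Longrightarrow> v i = power_limit A a s i) \<Longrightarrow> v \<in> Some -` U"
    by (rule Omega_neighbourhood) blast
  have "\<forall>\<^sub>F k in sequentially. p (s k) i = power_limit A a s i" if "i \<in> F" for i
  proof -
    obtain T \<phi> where "i = (T, \<phi>)" by (cases i)
    with that F(2) have i: "i = (T, \<phi>)" "(T, \<phi>) \<in> valuations fin_semigroups A" by auto
    then have "T \<in> fin_semigroups" "\<phi> a \<in> carrier T"
      using a by (auto simp: valuations_def)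
    then show ?thesis using power_convergent_fin_lim(2)[OF s] i by (simp add: p_def power_limit_def)
  qed
  then have "\<forall>\<^sub>F k in sequentially. \<forall>i\<in>F. p (s k) i = power_limit A a s i"
    using F(1) by (simp add: eventually_ball_finite)
  then obtain k where "\<forall>i\<in>F. p (s k) i = power_limit A a s i"
    unfolding eventually_sequentially by blast
  then have "Some (p (s k)) \<in> U" using nbhd[OF p_top] by auto
  then show "\<exists>y. y \<in> word1 fin_semigroups A ` range (\<lambda>n. replicate n a) \<and> y \<in> U"
    using p[OF pos] by (metis image_eqI rangeI)
qed


section \<open>Cyclic groups\<close>

definition cyc :: "nat \<Rightarrow> nat sgroup" where
  "cyc N = \<lparr>carrier = {..<N}, smul = (\<lambda>x y. (x + y) mod N)\<rparr>"

definition residue :: "nat \<Rightarrow> int \<Rightarrow> nat" where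
  "residue N c = nat (c mod int N)"

lemma int_residue: "N \<ge> 1 \<Longrightarrow> int (residue N c) = c mod int N"
  by (simp add: residue_def)

lemma residue_eq_iff: "N \<ge> 1 \<Longrightarrow> residue N a = residue N b \<longleftrightarrow> int N dvd a - b"
  by (metis int_residue mod_eq_dvd_iff of_nat_eq_iff)

lemma residue_in:
  assumes "N \<ge> 1" shows "residue N c \<in> carrier (cyc N)"
proof -
  have "int (residue N c) < int N" using assms by (simp add: int_residue)
  then show ?thesis by (simp add: cyc_def)
qed

lemma residue_of_nat: "x \<in> carrier (cyc N) \<Longrightarrow> x = residue N (int x)"
  by (auto simp: cyc_def residue_def simp flip: zmod_int)

lemma smul_residue:
  assumes "N \<ge> 1"
  shows "smul (cyc N) (residue N a) (residue N b) = residue N (a + b)"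
proof -
  have "int (smul (cyc N) (residue N a) (residue N b)) = (a mod int N + b mod int N) mod int N"
    using assms by (simp add: cyc_def zmod_int int_residue)
  also have "\<dots> = int (residue N (a + b))" using assms by (simp add: int_residue mod_add_eq)
  finally show ?thesis by simp
qed

lemma cyc_cases:
  assumes "x \<in> carrier (cyc N)" obtains c where "x = residue N c"
  using residue_of_nat[OF assms] by blast

lemma cyc_fin_semigroup:
  assumes N: "N \<ge> 1" shows "cyc N \<in> fin_semigroups"
  unfolding fin_semigroups_def mem_Collect_eq
proof (intro conjI ballI)
  show "carrier (cyc N) \<noteq> {}" using residue_in[OF N] by blast
  show "finite (carrier (cyc N))" by (simp add: cyc_def)
next
  fix x y assume "x \<in> carrier (cyc N)" "y \<in> carrier (cyc N)"
  then show "smul (cyc N) x y \<in> carrier (cyc N)"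
    by (elim cyc_cases) (simp add: smul_residue[OF N] residue_in[OF N])
next
  fix x y z assume "x \<in> carrier (cyc N)" "y \<in> carrier (cyc N)" "z \<in> carrier (cyc N)"
  then show "smul (cyc N) (smul (cyc N) x y) z = smul (cyc N) x (smul (cyc N) y z)"
    by (elim cyc_cases) (simp add: smul_residue[OF N] add.assoc)
qed

lemma cyc_unit:
  assumes N: "N \<ge> 1" and x: "x \<in> carrier (cyc N)"
  shows "smul (cyc N) (residue N 0) x = x" "smul (cyc N) x (residue N 0) = x"
  using x by (auto elim!: cyc_cases simp: smul_residue[OF N])

lemma sg_unit_cyc:
  assumes N: "N \<ge> 1" shows "sg_unit (cyc N) = residue N 0"
  unfolding sg_unit_def
proof (rule the_equality)
  show "residue N 0 \<in> carrier (cyc N) \<and>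
      (\<forall>x\<in>carrier (cyc N). smul (cyc N) (residue N 0) x = x \<and> smul (cyc N) x (residue N 0) = x)"
    using residue_in[OF N] cyc_unit[OF N] by blast
  fix e assume e: "e \<in> carrier (cyc N) \<and>
      (\<forall>x\<in>carrier (cyc N). smul (cyc N) e x = x \<and> smul (cyc N) x e = x)"
  then have "smul (cyc N) e (residue N 0) = residue N 0" using residue_in[OF N] by blast
  then show "e = residue N 0" using cyc_unit(2)[OF N] e by simp
qed

lemma cyc_in_G_nil:
  assumes N: "N \<ge> 1" shows "cyc N \<in> G_nil"
proof -
  let ?G = "as_monoid (cyc N)"
  have G: "carrier ?G = carrier (cyc N)" "monoid.mult ?G = smul (cyc N)" "one ?G = residue N 0"
    by (simp_all add: as_monoid_def sg_unit_cyc[OF N])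
  interpret comm_group ?G
  proof (rule comm_groupI, unfold G)
    fix x assume "x \<in> carrier (cyc N)"
    then obtain c where c: "x = residue N c" by (rule cyc_cases)
    show "\<exists>y\<in>carrier (cyc N). smul (cyc N) y x = residue N 0"
      by (rule bexI[of _ "residue N (- c)"]) (simp_all add: c smul_residue[OF N] residue_in[OF N])
  next
    fix x y assume "x \<in> carrier (cyc N)" "y \<in> carrier (cyc N)"
    then show "smul (cyc N) x y = smul (cyc N) y x"
      by (elim cyc_cases) (simp add: smul_residue[OF N] add.commute)
  next
    fix x assume "x \<in> carrier (cyc N)"
    then show "smul (cyc N) (residue N 0) x = x" by (rule cyc_unit(1)[OF N])
  next
    fix x y assume "x \<in> carrier (cyc N)" "y \<in> carrier (cyc N)"
    then show "smul (cyc N) x y \<in> carrier (cyc N)"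
      by (rule fin_semigroups_closed[OF cyc_fin_semigroup[OF N]])
  next
    fix x y z assume "x \<in> carrier (cyc N)" "y \<in> carrier (cyc N)" "z \<in> carrier (cyc N)"
    then show "smul (cyc N) (smul (cyc N) x y) z = smul (cyc N) x (smul (cyc N) y z)"
      by (rule fin_semigroups_assoc[OF cyc_fin_semigroup[OF N]])
  qed (rule residue_in[OF N])
  have comm: "x \<otimes>\<^bsub>?G\<^esub> y \<otimes>\<^bsub>?G\<^esub> inv\<^bsub>?G\<^esub> x \<otimes>\<^bsub>?G\<^esub> inv\<^bsub>?G\<^esub> y = \<one>\<^bsub>?G\<^esub>"
    if "x \<in> carrier ?G" "y \<in> carrier ?G" for x y
    using that by (simp add: m_comm[of x y] m_assoc)
  let ?C = "{x \<otimes>\<^bsub>?G\<^esub> y \<otimes>\<^bsub>?G\<^esub> inv\<^bsub>?G\<^esub> x \<otimes>\<^bsub>?G\<^esub> inv\<^bsub>?G\<^esub> y | x y.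
    x \<in> lower_central ?G 0 \<and> y \<in> carrier ?G}"
  have "?C \<subseteq> {\<one>\<^bsub>?G\<^esub>}"
  proof
    fix c assume "c \<in> ?C"
    then obtain x y where "c = x \<otimes>\<^bsub>?G\<^esub> y \<otimes>\<^bsub>?G\<^esub> inv\<^bsub>?G\<^esub> x \<otimes>\<^bsub>?G\<^esub> inv\<^bsub>?G\<^esub> y"
      "x \<in> carrier ?G" "y \<in> carrier ?G"
      unfolding lower_central.simps mem_Collect_eq by (elim exE conjE)
    then show "c \<in> {\<one>\<^bsub>?G\<^esub>}" by (simp only: comm singleton_iff)
  qed
  from mono_generate[OF this] have "generate ?G ?C \<subseteq> {\<one>\<^bsub>?G\<^esub>}" by (simp only: generate_one)
  moreover have "{\<one>\<^bsub>?G\<^esub>} \<subseteq> generate ?G ?C" using generate.one[of ?G ?C] by (rule insert_subsetI) (rule empty_subsetI)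
  ultimately have "lower_central ?G (Suc 0) = {\<one>\<^bsub>?G\<^esub>}"
    unfolding lower_central.simps(2) by (rule subset_antisym)
  then have "nilpotent_group ?G"
    unfolding nilpotent_group_def using is_group by blast
  then show ?thesis using cyc_fin_semigroup[OF N] by (simp add: G_nil_def)
qed

lemma spow_residue:
  assumes "N \<ge> 1" "n \<ge> 1"
  shows "spow (cyc N) (residue N c) n = residue N (int n * c)"
  using \<open>n \<ge> 1\<close>
  by (induction n rule: dec_induct)
    (simp_all add: spow_Suc smul_residue[OF \<open>N \<ge> 1\<close>] algebra_simps)

lemma omega_minus1_residue:
  assumes N: "N \<ge> 1"
  shows "omega_minus1 (cyc N) (residue N c) = residue N (- c)"
  unfolding omega_minus1_def
proof (rule fin_lim_eqI)
  show "\<forall>\<^sub>F k in sequentially. spow (cyc N) (residue N c) (fact k - 1) = residue N (- c)"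
    using eventually_dvd_fact[OF N] eventually_ge_at_top[of 2]
  proof eventually_elim
    case (elim k)
    have "(2 :: nat) \<le> fact k" using fact_ge_self[of k] elim(2) by linarith
    then have "spow (cyc N) (residue N c) (fact k - 1) = residue N (int (fact k - 1) * c)"
      by (intro spow_residue[OF N]) linarith
    also have "\<dots> = residue N (- c)"
    proof -
      have "int (fact k - 1) * c - - c = int (fact k) * c"
        using \<open>2 \<le> fact k\<close> by (simp add: of_nat_diff algebra_simps)
      moreover have "int N dvd int (fact k) * c"
        using elim(1) by (intro dvd_mult2) (simp only: of_nat_dvd_iff)
      ultimately show ?thesis by (simp only: residue_eq_iff[OF N])
    qed
    finally show ?case .
  qed
qed (rule residue_in[OF N])

lemma pow_pow_omega_residue_dvd:
  assumes p: "prime p" "p dvd m" and "m \<ge> 1"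
  shows "pow_pow_omega (cyc (p ^ k)) m (residue (p ^ k) c) = residue (p ^ k) 0"
proof -
  have N: "p ^ k \<ge> 1" using prime_gt_0_nat[OF p(1)] by simp
  show ?thesis
    unfolding pow_pow_omega_def
  proof (rule fin_lim_eqI)
    show "\<forall>\<^sub>F l in sequentially. spow (cyc (p ^ k)) (residue (p ^ k) c) (m ^ fact l) = residue (p ^ k) 0"
      using eventually_ge_at_top[of k]
    proof eventually_elim
      case (elim l)
      have "m ^ fact l \<ge> 1" using \<open>m \<ge> 1\<close> by simp
      then have "spow (cyc (p ^ k)) (residue (p ^ k) c) (m ^ fact l)
          = residue (p ^ k) (int (m ^ fact l) * c)"
        by (rule spow_residue[OF N])
      also have "\<dots> = residue (p ^ k) 0"
      proof -
        have "p ^ k dvd p ^ fact l"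
          using elim fact_ge_self[of l] by (intro le_imp_power_dvd) linarith
        also have "\<dots> dvd m ^ fact l" using p(2) by (rule dvd_power_same)
        finally have "int (p ^ k) dvd int (m ^ fact l) * c"
          by (intro dvd_mult2) (simp only: of_nat_dvd_iff)
        then show ?thesis by (simp only: residue_eq_iff[OF N] diff_zero)
      qed
      finally show ?case .
    qed
  qed (rule residue_in[OF N])
qed

lemma pow_pow_omega_residue_coprime:
  assumes N: "N \<ge> 1" and "coprime m N" and "m \<ge> 1"
  shows "pow_pow_omega (cyc N) m (residue N c) = residue N c"
  unfolding pow_pow_omega_def
proof (rule fin_lim_eqI)
  have "totient N \<ge> 1" using N by (simp add: Suc_leI)
  show "\<forall>\<^sub>F l in sequentially. spow (cyc N) (residue N c) (m ^ fact l) = residue N c"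
    using eventually_dvd_fact[OF \<open>totient N \<ge> 1\<close>]
  proof eventually_elim
    case (elim l)
    then obtain q where q: "fact l = totient N * q" by blast
    have "[(m ^ totient N) ^ q = 1 ^ q] (mod N)"
      by (rule cong_pow) (rule euler_theorem[OF \<open>coprime m N\<close>])
    then have "[m ^ fact l = 1] (mod N)" by (simp add: q power_mult)
    then have "[int (m ^ fact l) = int 1] (mod int N)" by (simp only: cong_int_iff)
    then have "int N dvd int (m ^ fact l) - 1" by (simp only: cong_iff_dvd_diff of_nat_1)
    then have "int N dvd (int (m ^ fact l) - 1) * c" by (rule dvd_mult2)
    then have "int N dvd int (m ^ fact l) * c - c" by (simp add: left_diff_distrib)
    moreover have "m ^ fact l \<ge> 1" using \<open>m \<ge> 1\<close> by simp
    ultimately show ?case by (simp only: spow_residue[OF N] residue_eq_iff[OF N])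
  qed
qed (rule residue_in[OF N])


section \<open>The operations of the signature\<close>

lemma omega_minus1_closed:
  "T \<in> fin_semigroups \<Longrightarrow> x \<in> carrier T \<Longrightarrow> omega_minus1 T x \<in> carrier T"
  unfolding omega_minus1_def by (rule power_convergent_fin_lim(1)[OF power_convergent_fact_minus_1])

lemma sg_hom_omega_minus1:
  assumes "T \<in> fin_semigroups" "T' \<in> fin_semigroups" "h \<in> sg_hom T T'" "x \<in> carrier T"
  shows "h (omega_minus1 T x) = omega_minus1 T' (h x)"
  unfolding omega_minus1_def by (rule sg_hom_fin_lim_spow[OF power_convergent_fact_minus_1 assms])

lemma kval_closed:
  assumes "T \<in> fin_semigroups" "\<And>i. i \<in> kletters w \<Longrightarrow> t i \<in> carrier T"
  shows "kval T t w \<in> carrier T"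
  using assms(2)
  by (induction w) (simp_all add: fin_semigroups_closed[OF assms(1)] omega_minus1_closed[OF assms(1)])

lemma sg_hom_kval:
  assumes T: "T \<in> fin_semigroups" "T' \<in> fin_semigroups" "h \<in> sg_hom T T'"
    and "\<And>i. i \<in> kletters w \<Longrightarrow> t i \<in> carrier T \<and> t' i = h (t i)"
  shows "h (kval T t w) = kval T' t' w"
  using assms(4)
proof (induction w)
  case (Times u v)
  have "kval T t u \<in> carrier T" "kval T t v \<in> carrier T"
    using Times.prems kval_closed[OF T(1)] by auto
  then have "h (kval T t (Times u v)) = smul T' (h (kval T t u)) (h (kval T t v))"
    using T(3) by (simp add: sg_hom_def)
  then show ?case using Times by simp
next
  case (OmegaMinus1 u)
  have "kval T t u \<in> carrier T" using OmegaMinus1.prems kval_closed[OF T(1)] by auto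
  then show ?case using OmegaMinus1 sg_hom_omega_minus1[OF T] by simp
qed simp

lemma transformation_in:
  assumes "T \<in> fin_semigroups" "\<forall>w\<in>set ws. kletters w \<subseteq> {..<length ws}"
  shows "transformation T ws \<in> ({..<length ws} \<rightarrow>\<^sub>E carrier T) \<rightarrow> ({..<length ws} \<rightarrow>\<^sub>E carrier T)"
proof
  fix t assume t: "t \<in> {..<length ws} \<rightarrow>\<^sub>E carrier T"
  have "kval T t (ws ! i) \<in> carrier T" if "i < length ws" for i
  proof (rule kval_closed[OF assms(1)])
    fix j assume "j \<in> kletters (ws ! i)"
    then have "j \<in> {..<length ws}" using assms(2) that by force
    then show "t j \<in> carrier T" using t by auto
  qed
  then show "transformation T ws t \<in> {..<length ws} \<rightarrow>\<^sub>E carrier T"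
    by (simp add: transformation_def)
qed

lemma finite_tuples: "T \<in> fin_semigroups \<Longrightarrow> finite ({..<n :: nat} \<rightarrow>\<^sub>E carrier T)"
  by (rule finite_PiE) (auto simp: fin_semigroups_def)

lemma sg_hom_transformation:
  assumes T: "T \<in> fin_semigroups" "T' \<in> fin_semigroups" "h \<in> sg_hom T T'"
    and ws: "\<forall>w\<in>set ws. kletters w \<subseteq> {..<length ws}"
    and t: "t \<in> {..<length ws} \<rightarrow>\<^sub>E carrier T"
  shows "restrict (h \<circ> transformation T ws t) {..<length ws} =
         transformation T' ws (restrict (h \<circ> t) {..<length ws})"
proof -
  have "h (kval T t (ws ! i)) = kval T' (restrict (h \<circ> t) {..<length ws}) (ws ! i)"
    if "i < length ws" for i
  proof (rule sg_hom_kval[OF T])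
    fix j assume "j \<in> kletters (ws ! i)"
    then have "j \<in> {..<length ws}" using ws that by force
    then show "t j \<in> carrier T \<and> restrict (h \<circ> t) {..<length ws} j = h (t j)" using t by auto
  qed
  then show ?thesis unfolding transformation_def by (intro restrict_ext) simp
qed

lemma idempotent_power_transformation_in:
  assumes "T \<in> fin_semigroups" "\<forall>w\<in>set ws. kletters w \<subseteq> {..<length ws}"
    and "t \<in> {..<length ws} \<rightarrow>\<^sub>E carrier T" "j < length ws"
  shows "idempotent_power ({..<length ws} \<rightarrow>\<^sub>E carrier T) (transformation T ws) t j \<in> carrier T"
  using idempotent_power_in[OF finite_tuples[OF assms(1)] transformation_in[OF assms(1,2)] assms(3)]
    assms(4) by (auto simp: PiE_iff)

lemma sigma_cases:
  assumes "(n, w) \<in> sigma"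
  obtains (mult) "n = 2" "w = (\<lambda>(T, t)\<in>valuations fin_semigroups {..<2}. smul T (t 0) (t 1))"
    | (omega) "n = 1" "w = (\<lambda>(T, t)\<in>valuations fin_semigroups {..<1}. omega_minus1 T (t 0))"
    | (added) ws j m where "n = length ws"
      "w = (\<lambda>(T, t)\<in>valuations fin_semigroups {..<length ws}. pow_pow_omega T m
         (idempotent_power ({..<length ws} \<rightarrow>\<^sub>E carrier T) (transformation T ws) t j))"
      "j < length ws" "m \<ge> 1" "\<forall>w\<in>set ws. kletters w \<subseteq> {..<length ws}"
      "det (exponent_matrix ws) \<noteq> 0"
      "\<forall>p::nat. prime p \<and> int p dvd det (exponent_matrix ws) \<longrightarrow> p dvd m"
  using assms unfolding sigma_def kappa_def Un_iff insert_iff mem_Collect_eq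
proof (elim disjE exE conjE)
  assume "(n, w) = implicit_op 2 (\<lambda>T t. smul T (t 0) (t 1))"
  then show thesis unfolding implicit_op_def prod.inject by (elim conjE) (rule mult)
next
  assume "(n, w) = implicit_op 1 (\<lambda>T t. omega_minus1 T (t 0))"
  then show thesis unfolding implicit_op_def prod.inject by (elim conjE) (rule omega)
next
  assume "(n, w) \<in> {}"
  then show thesis by (rule emptyE)
next
  fix ws j m
  assume "(n, w) = added_op ws j m"
    and conds: "j < length ws" "m \<ge> 1" "\<forall>w\<in>set ws. kletters w \<subseteq> {..<length ws}"
      "det (exponent_matrix ws) \<noteq> 0"
      "\<forall>p::nat. prime p \<and> int p dvd det (exponent_matrix ws) \<longrightarrow> p dvd m"
  then show thesis
    unfolding added_op_def implicit_op_def prod.inject by (elim conjE) (rule added[OF _ _ conds])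
qed

lemma sigma_operation_in_topspace:
  assumes "(n, w) \<in> sigma"
  shows "n \<ge> 1" "w \<in> topspace (Omega fin_semigroups {..<n})"
proof -
  show "n \<ge> 1"
    using assms
  proof (cases rule: sigma_cases)
    case (added ws j m)
    show ?thesis using added(1,3) by linarith
  qed simp_all
  show "w \<in> topspace (Omega fin_semigroups {..<n})"
    using assms
  proof (cases rule: sigma_cases)
    case mult
    show ?thesis
      unfolding mult
    proof (rule implicit_operation_in_topspace)
      fix T and t :: "nat \<Rightarrow> nat"
      assume T: "T \<in> fin_semigroups" "t \<in> {..<2} \<rightarrow>\<^sub>E carrier T"
      have t: "t 0 \<in> carrier T" "t 1 \<in> carrier T" by (rule PiE_mem[OF T(2)], simp)+
      show "smul T (t 0) (t 1) \<in> carrier T" by (rule fin_semigroups_closed[OF T(1) t])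
      fix T' h assume "h \<in> sg_hom T T'"
      then show "h (smul T (t 0) (t 1)) =
          smul T' (restrict (h \<circ> t) {..<2} 0) (restrict (h \<circ> t) {..<2} 1)"
        using t by (simp add: sg_hom_def)
    qed
  next
    case omega
    show ?thesis
      unfolding omega
    proof (rule implicit_operation_in_topspace)
      fix T and t :: "nat \<Rightarrow> nat"
      assume T: "T \<in> fin_semigroups" "t \<in> {..<1} \<rightarrow>\<^sub>E carrier T"
      have t: "t 0 \<in> carrier T" by (rule PiE_mem[OF T(2)]) simp
      show "omega_minus1 T (t 0) \<in> carrier T" by (rule omega_minus1_closed[OF T(1) t])
      fix T' h assume "T' \<in> fin_semigroups" "h \<in> sg_hom T T'"
      from sg_hom_omega_minus1[OF T(1) this t]
      show "h (omega_minus1 T (t 0)) = omega_minus1 T' (restrict (h \<circ> t) {..<1} 0)" by simp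
    qed
  next
    case (added ws j m)
    show ?thesis
      unfolding added(1,2)
    proof (rule implicit_operation_in_topspace)
      fix T and t :: "nat \<Rightarrow> nat"
      assume T: "T \<in> fin_semigroups" "t \<in> {..<length ws} \<rightarrow>\<^sub>E carrier T"
      show "pow_pow_omega T m
          (idempotent_power ({..<length ws} \<rightarrow>\<^sub>E carrier T) (transformation T ws) t j) \<in> carrier T"
        unfolding pow_pow_omega_def
        by (rule power_convergent_fin_lim(1)[OF power_convergent_power_fact[OF added(4)] T(1)
              idempotent_power_transformation_in[OF T(1) added(5) T(2) added(3)]])
    next
      fix T T' h and t :: "nat \<Rightarrow> nat"
      assume T: "T \<in> fin_semigroups" "T' \<in> fin_semigroups" "h \<in> sg_hom T T'"
        and t: "t \<in> {..<length ws} \<rightarrow>\<^sub>E carrier T"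
      let ?D = "\<lambda>T. {..<length ws} \<rightarrow>\<^sub>E carrier T"
      let ?H = "\<lambda>t. restrict (h \<circ> t) {..<length ws}"
      have eq: "?H (idempotent_power (?D T) (transformation T ws) t) =
          idempotent_power (?D T') (transformation T' ws) (?H t)"
      proof (rule idempotent_power_equivariant[where H = ?H])
        show "?H \<in> ?D T \<rightarrow> ?D T'" by (rule Pi_I) (rule sg_hom_valuation[OF T(3)])
        show "?H (transformation T ws x) = transformation T' ws (?H x)" if "x \<in> ?D T" for x
          by (rule sg_hom_transformation[OF T added(5) that])
      qed (rule finite_tuples[OF T(1)] finite_tuples[OF T(2)] t
          transformation_in[OF T(1) added(5)] transformation_in[OF T(2) added(5)])+
      have "h (idempotent_power (?D T) (transformation T ws) t j) =
          idempotent_power (?D T') (transformation T' ws) (?H t) j"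
        using fun_cong[OF eq, of j] added(3) by simp
      then show "h (pow_pow_omega T m (idempotent_power (?D T) (transformation T ws) t j)) =
          pow_pow_omega T' m (idempotent_power (?D T') (transformation T' ws) (?H t) j)"
        unfolding pow_pow_omega_def
        using sg_hom_fin_lim_spow[OF power_convergent_power_fact[OF added(4)] T
              idempotent_power_transformation_in[OF T(1) added(5) t added(3)]] by simp
    qed
  qed
qed


section \<open>Integrality of the operations of the signature\<close>

lemma kval_residue:
  assumes N: "N \<ge> 1" and "kletters w \<subseteq> {..<n}" and t: "\<And>i. i < n \<Longrightarrow> t i = residue N (c i)"
  shows "kval (cyc N) t w = residue N (\<Sum>j<n. exponent_sum j w * c j)"
  using assms(2)
proof (induction w)
  case (Letter i)
  have "(\<Sum>j<n. exponent_sum j (Letter i) * c j) = (\<Sum>j<n. if j = i then c i else 0)"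
    by (rule sum.cong) auto
  also have "\<dots> = c i" using Letter by simp
  finally show ?case using t Letter by simp
next
  case (Times u v)
  then show ?case by (simp add: smul_residue[OF N] sum.distrib distrib_right)
next
  case (OmegaMinus1 u)
  then show ?case by (simp add: omega_minus1_residue[OF N] sum_negf)
qed

text \<open>Multiplication by the adjugate turns \<open>M d \<equiv> 0\<close> into \<open>det M \<sqdot> d \<equiv> 0\<close>.\<close>

lemma dvd_of_matrix_system:
  fixes M :: "int mat"
  assumes M: "M \<in> carrier_mat n n" and "coprime (det M) N"
    and sys: "\<And>i. i < n \<Longrightarrow> N dvd (\<Sum>j<n. M $$ (i, j) * d j)" and j: "j < n"
  shows "N dvd d j"
proof -
  let ?A = "adj_mat M"
  have A: "?A \<in> carrier_mat n n" "?A * M = det M \<cdot>\<^sub>m 1\<^sub>m n" using adj_mat[OF M] by auto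
  have entry: "(\<Sum>i<n. ?A $$ (j, i) * M $$ (i, l)) = (if j = l then det M else 0)" if "l < n" for l
  proof -
    have "(\<Sum>i<n. ?A $$ (j, i) * M $$ (i, l)) = (?A * M) $$ (j, l)"
      using A(1) M j that
      by (auto simp: times_mat_def scalar_prod_def lessThan_atLeast0 intro!: sum.cong)
    also have "\<dots> = (if j = l then det M else 0)" using A(2) j that by simp
    finally show ?thesis .
  qed
  have "N dvd (\<Sum>i<n. ?A $$ (j, i) * (\<Sum>l<n. M $$ (i, l) * d l))"
  proof (rule dvd_sum)
    fix i assume "i \<in> {..<n}"
    then show "N dvd ?A $$ (j, i) * (\<Sum>l<n. M $$ (i, l) * d l)"
      by (intro dvd_mult sys) simp
  qed
  also have "(\<Sum>i<n. ?A $$ (j, i) * (\<Sum>l<n. M $$ (i, l) * d l)) =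
      (\<Sum>l<n. (\<Sum>i<n. ?A $$ (j, i) * M $$ (i, l)) * d l)"
    unfolding sum_distrib_left sum_distrib_right by (subst sum.swap) (simp add: mult.assoc)
  also have "\<dots> = (\<Sum>l<n. if l = j then det M * d j else 0)"
    by (rule sum.cong) (auto simp: entry)
  also have "\<dots> = det M * d j" using j by simp
  finally show ?thesis
    using \<open>coprime (det M) N\<close> by (metis coprime_commute coprime_dvd_mult_right_iff)
qed

lemma transformation_cyc_inj:
  assumes N: "N \<ge> 1" and ws: "\<forall>w\<in>set ws. kletters w \<subseteq> {..<length ws}"
    and det: "coprime (det (exponent_matrix ws)) (int N)"
  shows "inj_on (transformation (cyc N) ws) ({..<length ws} \<rightarrow>\<^sub>E carrier (cyc N))"
proof (rule inj_onI)
  let ?n = "length ws"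
  fix t t' assume t: "t \<in> {..<?n} \<rightarrow>\<^sub>E carrier (cyc N)" "t' \<in> {..<?n} \<rightarrow>\<^sub>E carrier (cyc N)"
    and eq: "transformation (cyc N) ws t = transformation (cyc N) ws t'"
  have res: "t i = residue N (int (t i))" "t' i = residue N (int (t' i))" if "i < ?n" for i
    using t that by (auto intro!: residue_of_nat)
  have row: "int N dvd (\<Sum>j<?n. exponent_matrix ws $$ (i, j) * (int (t j) - int (t' j)))" if i: "i < ?n" for i
  proof -
    have sub: "kletters (ws ! i) \<subseteq> {..<?n}" using ws i by simp
    have k: "kval (cyc N) t (ws ! i) = residue N (\<Sum>j<?n. exponent_sum j (ws ! i) * int (t j))"
      "kval (cyc N) t' (ws ! i) = residue N (\<Sum>j<?n. exponent_sum j (ws ! i) * int (t' j))"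
      by (rule kval_residue[OF N sub], erule res)+
    have "kval (cyc N) t (ws ! i) = kval (cyc N) t' (ws ! i)"
      using fun_cong[OF eq, of i] i by (simp add: transformation_def)
    then have "int N dvd (\<Sum>j<?n. exponent_sum j (ws ! i) * int (t j)) -
        (\<Sum>j<?n. exponent_sum j (ws ! i) * int (t' j))"
      unfolding k residue_eq_iff[OF N] .
    then show ?thesis
      using i by (simp add: exponent_matrix_def right_diff_distrib sum_subtractf)
  qed
  have M: "exponent_matrix ws \<in> carrier_mat ?n ?n" by (simp add: exponent_matrix_def)
  have "t j = t' j" if "j < ?n" for j
  proof -
    have "int N dvd int (t j) - int (t' j)"
      by (rule dvd_of_matrix_system[OF M det row that])
    then have "residue N (int (t j)) = residue N (int (t' j))" by (simp only: residue_eq_iff[OF N])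
    then show ?thesis unfolding res[OF that, symmetric] .
  qed
  then show "t = t'" by (intro PiE_ext[OF t]) simp
qed

text \<open>Modulo \<open>p\<^sup>k\<close>, with \<open>p\<close> fixed and \<open>k\<close> varying, an added operation
  has the value \<open>0\<close> if \<open>p\<close> divides \<open>m\<close>; otherwise \<open>p\<close> does not divide the determinant, the transformation
  is a permutation with trivial idempotent power, and the operation is the projection to the
  coordinate \<open>j\<close>. That one
  integer serves all \<open>k\<close> is what separates these values from general \<open>p\<close>-adic integers.\<close>

lemma sigma_operation_integral:
  assumes w: "(n, w) \<in> sigma" and p: "prime p"
  shows "\<exists>y. \<forall>k. w (cyc (p ^ k), \<lambda>i\<in>{..<n}. residue (p ^ k) (z i)) = residue (p ^ k) y"
proof -
  have N: "p ^ k \<ge> 1" for k using prime_gt_0_nat[OF p] by simp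
  have tuple: "(\<lambda>i\<in>{..<n}. residue (p ^ k) (z i)) \<in> {..<n} \<rightarrow>\<^sub>E carrier (cyc (p ^ k))" for k n
    using residue_in[OF N] by simp
  have val: "(\<lambda>(T, t)\<in>valuations fin_semigroups {..<n}. F T t)
      (cyc (p ^ k), \<lambda>i\<in>{..<n}. residue (p ^ k) (z i)) =
      F (cyc (p ^ k)) (\<lambda>i\<in>{..<n}. residue (p ^ k) (z i))" for F :: "nat sgroup \<Rightarrow> (nat \<Rightarrow> nat) \<Rightarrow> nat" and k n
    using tuple cyc_fin_semigroup[OF N] by (simp add: valuations_def)
  show ?thesis
    using w
  proof (cases rule: sigma_cases)
    case mult
    show ?thesis
      unfolding mult val by (rule exI[of _ "z 0 + z 1"]) (simp add: smul_residue[OF N])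
  next
    case omega
    show ?thesis
      unfolding omega val by (rule exI[of _ "- z 0"]) (simp add: omega_minus1_residue[OF N])
  next
    case (added ws j m)
    let ?D = "\<lambda>k. {..<length ws} \<rightarrow>\<^sub>E carrier (cyc (p ^ k))"
    let ?g = "\<lambda>k. idempotent_power (?D k) (transformation (cyc (p ^ k)) ws)
      (\<lambda>i\<in>{..<length ws}. residue (p ^ k) (z i)) j"
    show ?thesis
    proof (cases "p dvd m")
      case True
      have "pow_pow_omega (cyc (p ^ k)) m (?g k) = residue (p ^ k) 0" for k
      proof -
        have "?g k \<in> carrier (cyc (p ^ k))"
          by (rule idempotent_power_transformation_in[OF cyc_fin_semigroup[OF N] added(5) tuple added(3)])
        then obtain c where "?g k = residue (p ^ k) c" by (rule cyc_cases)
        then show ?thesis using pow_pow_omega_residue_dvd[OF p True added(4)] by simp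
      qed
      then show ?thesis unfolding added(1,2) val by blast
    next
      case False
      have "\<not> int p dvd det (exponent_matrix ws)" using added(7) p False by blast
      then have "coprime (int p) (det (exponent_matrix ws))"
        using p by (intro prime_imp_coprime) auto
      then have det: "coprime (det (exponent_matrix ws)) (int (p ^ k))" for k
        by (simp add: coprime_commute)
      have "coprime p m" using p False by (rule prime_imp_coprime)
      then have m: "coprime m (p ^ k)" for k by (simp add: coprime_commute)
      have "pow_pow_omega (cyc (p ^ k)) m (?g k) = residue (p ^ k) (z j)" for k
      proof -
        have "idempotent_power (?D k) (transformation (cyc (p ^ k)) ws)
            (\<lambda>i\<in>{..<length ws}. residue (p ^ k) (z i)) = (\<lambda>i\<in>{..<length ws}. residue (p ^ k) (z i))"
          using finite_tuples[OF cyc_fin_semigroup[OF N]]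
            transformation_in[OF cyc_fin_semigroup[OF N] added(5)]
            transformation_cyc_inj[OF N added(5) det] tuple
          by (rule idempotent_power_inj)
        then have "?g k = residue (p ^ k) (z j)" using added(3) by simp
        then show ?thesis using pow_pow_omega_residue_coprime[OF N m added(4)] by simp
      qed
      then show ?thesis unfolding added(1,2) val by blast
    qed
  qed
qed

lemma cont_hom_compose:
  assumes "cont_hom X m Y m' f" "cont_hom Y m' Z m'' g"
  shows "cont_hom X m Z m'' (\<lambda>x. g (f x))"
proof -
  have f: "continuous_map X Y f" and g: "continuous_map Y Z g"
    using assms by (auto simp: cont_hom_def)
  have "continuous_map X Z (\<lambda>x. g (f x))"
    using continuous_map_compose[OF f g] by (simp add: o_def)
  then show ?thesis
    using assms continuous_map_image_subset_topspace[OF f] unfolding cont_hom_def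
    by (metis (full_types) image_subset_iff)
qed

lemma cont_hom_coordinate:
  assumes "T \<in> fin_semigroups" "\<phi> \<in> A \<rightarrow>\<^sub>E carrier T"
  shows "cont_hom (Omega fin_semigroups A) (pmul fin_semigroups A)
    (discrete_topology (carrier T)) (smul T) (\<lambda>w. w (T, \<phi>))"
  using continuous_map_coordinate[OF assms] pmul_apply[OF assms] by (simp add: cont_hom_def)

text \<open>Each letter \<open>a\<close> is sent to an integer \<open>c a\<close>, compatibly for all \<open>k\<close>. The value of a general
  pseudoword would be a \<open>p\<close>-adic integer; that of a \<open>\<sigma>\<close>-word is an integer.\<close>

lemma Omega_sig_sigma_integral:
  fixes c :: "'a \<Rightarrow> int"
  assumes p: "prime p" and "w \<in> Omega_sig sigma A"
  shows "\<exists>z. \<forall>k. w (cyc (p ^ k), \<lambda>a\<in>A. residue (p ^ k) (c a)) = residue (p ^ k) z"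
proof -
  have N: "p ^ k \<ge> 1" for k using prime_gt_0_nat[OF p] by simp
  have tuple: "(\<lambda>a\<in>A. residue (p ^ k) (c a)) \<in> A \<rightarrow>\<^sub>E carrier (cyc (p ^ k))" for k
    using residue_in[OF N] by simp
  show ?thesis
    using assms(2)
  proof (induction rule: Omega_sig.induct)
    case (gen a)
    show ?case
      unfolding letter_apply[OF cyc_fin_semigroup[OF N] tuple]
      by (rule exI[of _ "c a"]) (simp add: gen)
  next
    case (app n w f)
    have "\<forall>i\<in>{..<n}. \<exists>y. \<forall>k. f (letter fin_semigroups {..<n} i)
        (cyc (p ^ k), \<lambda>a\<in>A. residue (p ^ k) (c a)) = residue (p ^ k) y"
      using app(4) by blast
    from bchoice[OF this] obtain z where z: "\<And>i k. i < n \<Longrightarrow> f (letter fin_semigroups {..<n} i)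
        (cyc (p ^ k), \<lambda>a\<in>A. residue (p ^ k) (c a)) = residue (p ^ k) (z i)"
      by blast
    have "{..<n} \<noteq> {}" using sigma_operation_in_topspace(1)[OF app(1)] by (auto simp: lessThan_empty_iff)
    have "f w (cyc (p ^ k), \<lambda>a\<in>A. residue (p ^ k) (c a)) =
        w (cyc (p ^ k), \<lambda>i\<in>{..<n}. residue (p ^ k) (z i))" for k
    proof -
      have "f w (cyc (p ^ k), \<lambda>a\<in>A. residue (p ^ k) (c a)) = w (cyc (p ^ k), \<lambda>i\<in>{..<n}.
          f (letter fin_semigroups {..<n} i) (cyc (p ^ k), \<lambda>a\<in>A. residue (p ^ k) (c a)))"
        by (rule continuous_hom_eq_evaluation[OF
              cont_hom_compose[OF app(2) cont_hom_coordinate[OF cyc_fin_semigroup[OF N] tuple]]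
              cyc_fin_semigroup[OF N] \<open>{..<n} \<noteq> {}\<close> sigma_operation_in_topspace(2)[OF app(1)]])
      also have "(\<lambda>i\<in>{..<n}. f (letter fin_semigroups {..<n} i)
          (cyc (p ^ k), \<lambda>a\<in>A. residue (p ^ k) (c a))) = (\<lambda>i\<in>{..<n}. residue (p ^ k) (z i))"
        by (rule restrict_ext) (simp add: z)
      finally show ?thesis .
    qed
    then show ?case using sigma_operation_integral[OF app(1) p, of z] by (simp only:)
  qed
qed


section \<open>The system\<close>

lemma pmul_power_limit:
  assumes a: "a \<in> A" and conv: "power_convergent s" "power_convergent s'" "power_convergent (\<lambda>k. s k + s' k)"
    and pos: "\<And>k. s k \<ge> 1" "\<And>k. s' k \<ge> 1"
  shows "pmul fin_semigroups A (power_limit A a s) (power_limit A a s') =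
         power_limit A a (\<lambda>k. s k + s' k)"
  unfolding pmul_def power_limit_def
proof (rule restrict_ext, clarify)
  fix T :: "nat sgroup" and \<phi> assume v: "(T, \<phi>) \<in> valuations fin_semigroups A"
  then have T: "T \<in> fin_semigroups" and x: "\<phi> a \<in> carrier T"
    using a by (auto simp: valuations_def)
  let ?l = "\<lambda>s. fin_lim T (\<lambda>k. spow T (\<phi> a) (s k))"
  have "\<forall>\<^sub>F k in sequentially. spow T (\<phi> a) (s k + s' k) = smul T (?l s) (?l s')"
    using power_convergent_fin_lim(2)[OF conv(1) T x] power_convergent_fin_lim(2)[OF conv(2) T x]
    by eventually_elim (simp only: spow_add[OF T x pos])
  then have "?l (\<lambda>k. s k + s' k) = smul T (?l s) (?l s')"
    by (rule fin_lim_eqI[rotated])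
      (rule fin_semigroups_closed[OF T power_convergent_fin_lim(1)[OF conv(1) T x]
          power_convergent_fin_lim(1)[OF conv(2) T x]])
  then show "smul T ((\<lambda>(T, \<phi>)\<in>valuations fin_semigroups A. fin_lim T (\<lambda>k. spow T (\<phi> a) (s k))) (T, \<phi>))
      ((\<lambda>(T, \<phi>)\<in>valuations fin_semigroups A. fin_lim T (\<lambda>k. spow T (\<phi> a) (s' k))) (T, \<phi>)) =
      ?l (\<lambda>k. s k + s' k)"
    using v by simp
qed

lemma substitute_implicit_operation:
  assumes t: "t \<in> A \<rightarrow> topspace (Omega fin_semigroups B)"
  shows "substitute A B t (\<lambda>(T, \<phi>)\<in>valuations fin_semigroups A. F T \<phi>) =
    (\<lambda>(T, \<phi>)\<in>valuations fin_semigroups B. F T (\<lambda>a\<in>A. t a (T, \<phi>)))"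
  unfolding substitute_def
proof (rule restrict_ext, clarify)
  fix T :: "nat sgroup" and \<phi> assume "(T, \<phi>) \<in> valuations fin_semigroups B"
  then have "(T, \<lambda>a\<in>A. t a (T, \<phi>)) \<in> valuations fin_semigroups A"
    using t by (auto simp: valuations_def topspace_Omega Pi_iff)
  then show "(\<lambda>(T, \<phi>)\<in>valuations fin_semigroups A. F T \<phi>) (T, \<lambda>a\<in>A. t a (T, \<phi>)) =
      F T (\<lambda>a\<in>A. t a (T, \<phi>))" by simp
qed

lemma substitute_power_limit:
  assumes t: "t \<in> A \<rightarrow> topspace (Omega fin_semigroups B)" and a: "a \<in> A"
    and ta: "t a = letter fin_semigroups B b"
  shows "substitute A B t (power_limit A a s) = power_limit B b s"
  unfolding power_limit_def[of A] substitute_implicit_operation[OF t] unfolding power_limit_def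
proof (rule restrict_ext, clarify)
  fix T :: "nat sgroup" and \<phi> assume "(T, \<phi>) \<in> valuations fin_semigroups B"
  then have "t a (T, \<phi>) = \<phi> b" unfolding ta letter_def by simp
  then show "fin_lim T (\<lambda>k. spow T ((\<lambda>a\<in>A. t a (T, \<phi>)) a) (s k)) = fin_lim T (\<lambda>k. spow T (\<phi> b) (s k))"
    using a by simp
qed

lemma pmul_in_Omega_sig:
  assumes "a \<in> B" "b \<in> B"
  shows "pmul fin_semigroups B (letter fin_semigroups B a) (letter fin_semigroups B b)
    \<in> Omega_sig sigma B"
proof -
  let ?w = "\<lambda>(T, t)\<in>valuations fin_semigroups {..<2}. smul T (t 0) (t 1)"
  define t where "t i = letter fin_semigroups B (if i = 0 then a else b)" for i :: nat
  have t: "t \<in> {..<2} \<rightarrow> topspace (Omega fin_semigroups B)"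
    using assms by (auto simp: t_def intro!: letter_in_topspace)
  have sigma: "(2, ?w) \<in> sigma" unfolding sigma_def kappa_def implicit_op_def by (rule UnI1) (rule insertI1)
  have "substitute {..<2} B t (letter fin_semigroups {..<2} i) \<in> Omega_sig sigma B"
    if "i < 2" for i
    using that assms by (simp add: substitute_letter[OF t] t_def Omega_sig.gen)
  from Omega_sig.app[OF sigma cont_hom_substitute[OF t] this]
  have "substitute {..<2} B t ?w \<in> Omega_sig sigma B" .
  also have "substitute {..<2} B t ?w =
      pmul fin_semigroups B (letter fin_semigroups B a) (letter fin_semigroups B b)"
    unfolding substitute_implicit_operation[OF t] pmul_def by (rule restrict_ext) (auto simp: t_def)
  finally show ?thesis .
qed

text \<open>The operation \<open>lim x\<^bsup>m^(k!)\<^esup>\<close> is the added operation of the one-letter substitution \<open>a\<^sub>1 \<mapsto> a\<^sub>1\<close>,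
  whose determinant is \<open>1\<close>.\<close>

lemma power_limit_in_Omega_sig:
  assumes "b \<in> B" and m: "m \<ge> 1"
  shows "power_limit B b (\<lambda>k. m ^ fact k) \<in> Omega_sig sigma B"
proof -
  let ?D = "\<lambda>T :: nat sgroup. {..<length [Letter 0]} \<rightarrow>\<^sub>E carrier T"
  let ?w = "\<lambda>(T, t)\<in>valuations fin_semigroups {..<length [Letter 0]}.
    pow_pow_omega T m (idempotent_power (?D T) (transformation T [Letter 0]) t 0)"
  have "exponent_matrix [Letter 0] = 1\<^sub>m 1"
    by (rule eq_matI) (auto simp: exponent_matrix_def)
  then have det: "det (exponent_matrix [Letter 0]) = 1" by (simp only: det_one)
  have "(length [Letter 0], ?w) = added_op [Letter 0] 0 m"
    unfolding added_op_def implicit_op_def ..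
  moreover have "added_op [Letter 0] 0 m \<in> sigma"
    unfolding sigma_def
  proof (rule UnI2, intro CollectI exI conjI)
    show "\<forall>p::nat. prime p \<and> int p dvd det (exponent_matrix [Letter 0]) \<longrightarrow> p dvd m"
      unfolding det using not_prime_unit by auto
  qed (use m det in auto)
  ultimately have sigma: "(length [Letter 0], ?w) \<in> sigma" by (simp only:)
  let ?t = "\<lambda>_ :: nat. letter fin_semigroups B b"
  have t: "?t \<in> {..<length [Letter 0]} \<rightarrow> topspace (Omega fin_semigroups B)"
    using letter_in_topspace[OF assms(1)] by blast
  have "substitute {..<length [Letter 0]} B ?t (letter fin_semigroups {..<length [Letter 0]} i)
      \<in> Omega_sig sigma B" if "i < length [Letter 0]" for i
    using that Omega_sig.gen[OF assms(1)] by (simp only: substitute_letter[OF t] lessThan_iff)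
  from Omega_sig.app[OF sigma cont_hom_substitute[OF t] this]
  have "substitute {..<length [Letter 0]} B ?t ?w \<in> Omega_sig sigma B" .
  also have "substitute {..<length [Letter 0]} B ?t ?w = power_limit B b (\<lambda>k. m ^ fact k)"
    unfolding substitute_implicit_operation[OF t] power_limit_def
  proof (rule restrict_ext, clarify)
    fix T :: "nat sgroup" and \<phi> assume v: "(T, \<phi>) \<in> valuations fin_semigroups B"
    then have T: "T \<in> fin_semigroups" and x: "\<phi> b \<in> carrier T"
      using assms(1) by (auto simp: valuations_def)
    have l: "letter fin_semigroups B b (T, \<phi>) = \<phi> b" using v by (simp add: letter_def)
    define u where "u = (\<lambda>i\<in>{..<length [Letter 0]}. letter fin_semigroups B b (T, \<phi>))"
    have u: "u \<in> ?D T" using x l by (simp add: u_def)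
    have id: "transformation T [Letter 0] t = t" if "t \<in> ?D T" for t
    proof (rule PiE_ext[OF _ that])
      show "transformation T [Letter 0] t \<in> ?D T"
        by (rule funcset_mem[OF transformation_in[OF T] that]) simp
      fix i assume "i \<in> {..<length [Letter 0]}"
      then show "transformation T [Letter 0] t i = t i" by (simp add: transformation_def)
    qed
    have "idempotent_power (?D T) (transformation T [Letter 0]) u = u"
    proof (rule idempotent_power_inj[OF finite_tuples[OF T] _ _ u])
      show "transformation T [Letter 0] \<in> ?D T \<rightarrow> ?D T" using id by simp
      show "inj_on (transformation T [Letter 0]) (?D T)" using id by (simp add: inj_on_def)
    qed
    then have "idempotent_power (?D T) (transformation T [Letter 0]) u 0 = \<phi> b"
      by (simp add: u_def l)
    then show "pow_pow_omega T m (idempotent_power (?D T) (transformation T [Letter 0])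
        (\<lambda>i\<in>{..<length [Letter 0]}. letter fin_semigroups B b (T, \<phi>)) 0) =
        fin_lim T (\<lambda>k. spow T (\<phi> b) (m ^ fact k))"
      unfolding u_def pow_pow_omega_def by (simp only:)
  qed
  finally show ?thesis .
qed

lemma rational_powers: "a \<in> A \<Longrightarrow> rational A (range (\<lambda>n. replicate n a))"
proof -
  assume "a \<in> A"
  then have "rational A {concat us | us. set us \<subseteq> {[a]}}"
    by (intro rational.star rational.single)
  also have "{concat us | us. set us \<subseteq> {[a]}} = range (\<lambda>n. replicate n a)"
  proof (intro equalityI subsetI)
    fix w assume "w \<in> {concat us | us. set us \<subseteq> {[a]}}"
    then obtain us where us: "w = concat us" "set us \<subseteq> {[a]}" by blast
    then have "w = replicate (length us) a" by (induction us arbitrary: w) auto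
    then show "w \<in> range (\<lambda>n. replicate n a)" by (rule range_eqI)
  next
    fix w assume "w \<in> range (\<lambda>n. replicate n a)"
    then obtain n where n: "w = replicate n a" by blast
    have "concat (replicate n [a]) = replicate n a" by (induction n) auto
    then have "w = concat (replicate n [a]) \<and> set (replicate n [a]) \<subseteq> {[a]}" using n by auto
    then show "w \<in> {concat us | us. set us \<subseteq> {[a]}}" by blast
  qed
  finally show ?thesis .
qed

lemma psi_apply:
  assumes "T \<in> V" "\<phi> \<in> A \<rightarrow>\<^sub>E carrier T"
  shows "psi V A y (T, \<phi>) = (case y of None \<Rightarrow> sg_unit T | Some w \<Rightarrow> w (T, \<phi>))"
  using assms by (cases y) (simp_all add: valuations_def)

lemma cont_hom_evaluation1:
  assumes T: "T \<in> fin_semigroups" "\<phi> \<in> A \<rightarrow>\<^sub>E carrier T"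
    and e: "e \<in> carrier T" "\<And>x. x \<in> carrier T \<Longrightarrow> smul T e x = x" "\<And>x. x \<in> carrier T \<Longrightarrow> smul T x e = x"
  shows "cont_hom (Omega1 fin_semigroups A) (pmul1 fin_semigroups A)
    (discrete_topology (carrier T)) (smul T) (\<lambda>y. case y of None \<Rightarrow> e | Some w \<Rightarrow> w (T, \<phi>))"
  unfolding cont_hom_def
proof (intro conjI ballI)
  show "continuous_map (Omega1 fin_semigroups A) (discrete_topology (carrier T))
      (\<lambda>y. case y of None \<Rightarrow> e | Some w \<Rightarrow> w (T, \<phi>))"
    by (rule continuous_map_from_Omega1) (simp_all add: continuous_map_coordinate[OF T] e(1))
  fix u v assume u: "u \<in> topspace (Omega1 fin_semigroups A)" and v: "v \<in> topspace (Omega1 fin_semigroups A)"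
  have "w (T, \<phi>) \<in> carrier T" if "w \<in> topspace (Omega fin_semigroups A)" for w
    using that T unfolding topspace_Omega by blast
  then show "(case pmul1 fin_semigroups A u v of None \<Rightarrow> e | Some w \<Rightarrow> w (T, \<phi>)) =
      smul T (case u of None \<Rightarrow> e | Some w \<Rightarrow> w (T, \<phi>)) (case v of None \<Rightarrow> e | Some w \<Rightarrow> w (T, \<phi>))"
    using u v by (cases u; cases v) (auto simp: topspace_Omega1 e pmul_apply[OF T])
qed

theorem corollary3p12:
  shows "\<not> completely_reducible sigma G_nil"
proof
  assume red: "completely_reducible sigma G_nil"
  let ?S = "fin_semigroups"
  \<comment> \<open>\<open>0\<close> is the letter and the variable, \<open>1\<close> is the parameter, with the letter as its value.\<close>
  let ?A = "{0 :: nat}" and ?B = "{0} \<union> {1 :: nat}"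
  define half where "half = power_limit ?A 0 (\<lambda>k. 2 ^ (fact k - 1))"
  define lhs where "lhs = pmul ?S ?B (letter ?S ?B 0) (letter ?S ?B 0)"
  define rhs where "rhs = power_limit ?B 1 (\<lambda>k. 2 ^ fact k)"
  define L where "L = (\<lambda>_ :: nat. range (\<lambda>n. replicate n (0 :: nat)))"
  define w where "w = (\<lambda>_ :: nat. letter ?S ?A 0)"
  have lhs: "lhs \<in> topspace (Omega ?S ?B)"
    unfolding lhs_def by (intro pmul_in_topspace letter_in_topspace) simp_all
  have rhs: "rhs \<in> topspace (Omega ?S ?B)"
    unfolding rhs_def by (rule power_limit_in_topspace[OF _ power_convergent_power_fact]) simp_all
  have conv: "power_convergent (\<lambda>k. 2 ^ (fact k - 1))"
    by (rule power_convergent_power_fact_minus_1) simp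
  have half: "half \<in> topspace (Omega ?S ?A)"
    unfolding half_def
    by (rule power_limit_in_topspace[OF _ conv]) simp
  have letter: "letter ?S ?A 0 \<in> topspace (Omega ?S ?A)" by (rule letter_in_topspace) simp
  have double: "pmul ?S ?A half half = power_limit ?A 0 (\<lambda>k. 2 ^ fact k)"
  proof -
    have e: "2 ^ (fact k - 1) + 2 ^ (fact k - 1) = (2 ^ fact k :: nat)" for k
      using fact_ge_1[of k, where 'a = nat] by (cases "fact k :: nat") auto
    have conv': "power_convergent (\<lambda>k. 2 ^ (fact k - 1) + 2 ^ (fact k - 1))"
      unfolding e by (rule power_convergent_power_fact) simp
    show ?thesis
      unfolding half_def e[symmetric] by (rule pmul_power_limit[OF _ conv conv conv']) simp_all
  qed

  define \<delta> where "\<delta> = (\<lambda>y :: nat. Some (if y = 0 then half else letter ?S ?A 0))"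
  have "solution G_nil ?A {0} {1} {(lhs, rhs)} L w \<delta>"
    unfolding solution_def
  proof (intro conjI)
    show "\<delta> \<in> ?B \<rightarrow> topspace (Omega1 ?S ?A)"
      using half letter by (simp add: \<delta>_def topspace_Omega1)
    show "\<forall>x\<in>{0}. \<delta> x \<in> Omega1 ?S ?A closure_of word1 ?S ?A ` L x"
      using power_limit_in_closure[OF _ conv, of 0 ?A] by (simp add: \<delta>_def L_def half_def)
    show "\<forall>p\<in>{1}. \<delta> p = Some (w p)" by (simp add: \<delta>_def w_def)
    define t where "t = (\<lambda>y :: nat. if y = 0 then half else letter ?S ?A 0)"
    have t: "t \<in> ?B \<rightarrow> topspace (Omega ?S ?A)" using half letter by (simp add: t_def)
    let ?d = "\<lambda>u. Some (substitute ?B ?A t u)"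
    have "cont_hom (Omega ?S ?A) (pmul ?S ?A) (Omega1 ?S ?A) (pmul1 ?S ?A) Some"
      by (simp add: cont_hom_def continuous_map_Some)
    from cont_hom_compose[OF cont_hom_substitute[OF t] this]
    have d: "cont_hom (Omega ?S ?B) (pmul ?S ?B) (Omega1 ?S ?A) (pmul1 ?S ?A) ?d" .
    have "substitute ?B ?A t lhs = pmul ?S ?A (t 0) (t 0)"
      using cont_hom_substitute[OF t] letter_in_topspace[of 0 ?B ?S] substitute_letter[OF t, of 0]
      unfolding lhs_def cont_hom_def by simp
    also have "\<dots> = power_limit ?A 0 (\<lambda>k. 2 ^ fact k)" by (simp add: t_def double)
    also have "\<dots> = substitute ?B ?A t rhs"
      unfolding rhs_def by (rule substitute_power_limit[OF t, symmetric]) (simp_all add: t_def)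
    finally have eq: "substitute ?B ?A t lhs = substitute ?B ?A t rhs" .
    show "\<exists>d. cont_hom (Omega ?S ?B) (pmul ?S ?B) (Omega1 ?S ?A) (pmul1 ?S ?A) d \<and>
        (\<forall>y\<in>?B. d (letter ?S ?B y) = \<delta> y) \<and>
        (\<forall>(u, v)\<in>{(lhs, rhs)}. psi G_nil ?A (d u) = psi G_nil ?A (d v))"
    proof (intro exI conjI)
      show "\<forall>y\<in>?B. ?d (letter ?S ?B y) = \<delta> y"
        using substitute_letter[OF t] by (simp add: \<delta>_def t_def)
      show "\<forall>(u, v)\<in>{(lhs, rhs)}. psi G_nil ?A (?d u) = psi G_nil ?A (?d v)"
        by (simp only: ball_simps prod.case eq simp_thms)
    qed (rule d)
  qed
  moreover have "{(lhs, rhs)} \<subseteq> Omega_sig sigma ?B \<times> Omega_sig sigma ?B"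
    unfolding lhs_def rhs_def using pmul_in_Omega_sig[of 0 ?B 0] power_limit_in_Omega_sig[of 1 ?B 2]
    by simp
  moreover have "\<forall>x\<in>{0}. rational ?A (L x)" by (simp add: L_def rational_powers)
  moreover have "\<forall>p\<in>{1}. w p \<in> Omega_sig sigma ?A" by (simp add: w_def Omega_sig.gen)
  ultimately obtain \<delta>' where sol: "solution G_nil ?A {0} {1} {(lhs, rhs)} L w \<delta>'"
    and \<delta>': "\<delta>' 0 \<in> insert None (Some ` Omega_sig sigma ?A)"
    using red[unfolded completely_reducible_def, rule_format, of ?A "{0}" "{1}" "{(lhs, rhs)}" L w]
    unfolding reducible_for_def by auto
  obtain d where d: "cont_hom (Omega ?S ?B) (pmul ?S ?B) (Omega1 ?S ?A) (pmul1 ?S ?A) d"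
    "\<forall>y\<in>?B. d (letter ?S ?B y) = \<delta>' y" "\<forall>(u, v)\<in>{(lhs, rhs)}. psi G_nil ?A (d u) = psi G_nil ?A (d v)"
    using sol unfolding solution_def by (elim conjE exE)
  have equal: "psi G_nil ?A (d lhs) = psi G_nil ?A (d rhs)"
    using d(3) by (simp only: ball_simps prod.case simp_thms)
  have \<delta>'1: "\<delta>' 1 = Some (letter ?S ?A 0)" using sol unfolding solution_def w_def by auto

  \<comment> \<open>Evaluation in the cyclic group of order \<open>3^k\<close>, the letter going to the generator \<open>1\<close>. The identity
    adjoined to the free profinite semigroup, a possible value of the variable, goes to \<open>0\<close>.\<close>
  have N: "(3 :: nat) ^ k \<ge> 1" for k by simp
  define \<phi> where "\<phi> k = (\<lambda>a\<in>?A. residue (3 ^ k) 1)" for k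
  have \<phi>: "\<phi> k \<in> ?A \<rightarrow>\<^sub>E carrier (cyc (3 ^ k))" for k using residue_in[OF N] by (simp add: \<phi>_def)
  define ev where "ev k y = (case y of None \<Rightarrow> residue (3 ^ k) 0 | Some u \<Rightarrow> u (cyc (3 ^ k), \<phi> k))"
    for k and y :: "nat pword option"
  obtain z where z: "ev k (\<delta>' 0) = residue (3 ^ k) z" for k
  proof (cases "\<delta>' 0")
    case None
    then show thesis by (intro that[of 0]) (simp add: ev_def)
  next
    case (Some x)
    then have "x \<in> Omega_sig sigma ?A" using \<delta>' by auto
    from Omega_sig_sigma_integral[OF _ this, of 3 "\<lambda>_. 1"] obtain z where
      "\<forall>k. x (cyc (3 ^ k), \<lambda>a\<in>?A. residue (3 ^ k) 1) = residue (3 ^ k) z" by auto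
    then show thesis by (intro that[of z]) (simp add: ev_def Some \<phi>_def)
  qed
  have dvd: "int (3 ^ k) dvd 2 * z - 1" for k
  proof -
    note C = cyc_fin_semigroup[OF N[of k]]
    have "cont_hom (Omega1 ?S ?A) (pmul1 ?S ?A) (discrete_topology (carrier (cyc (3 ^ k))))
        (smul (cyc (3 ^ k))) (ev k)"
      unfolding ev_def by (rule cont_hom_evaluation1[OF C \<phi> residue_in[OF N] cyc_unit[OF N]])
    note hom = cont_hom_compose[OF d(1) this]
    define \<chi> where "\<chi> = (\<lambda>y\<in>?B. ev k (d (letter ?S ?B y)))"
    have \<chi>_eq: "\<chi> y = ev k (\<delta>' y)" if "y \<in> ?B" for y
      using bspec[OF d(2) that] by (simp only: \<chi>_def restrict_apply'[OF that])
    have "ev k (\<delta>' 1) = \<phi> k 0"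
      unfolding \<delta>'1 ev_def option.case letter_apply[OF C \<phi>] ..
    then have \<chi>01: "\<chi> 0 = residue (3 ^ k) z" "\<chi> 1 = residue (3 ^ k) 1"
      using \<chi>_eq[of 0] \<chi>_eq[of 1] z[of k] by (simp_all add: \<phi>_def)
    have \<chi>: "\<chi> \<in> ?B \<rightarrow>\<^sub>E carrier (cyc (3 ^ k))"
    proof (rule PiE_I)
      fix y assume "y \<in> ?B"
      then have "y = 0 \<or> y = 1" by auto
      then show "\<chi> y \<in> carrier (cyc (3 ^ k))" using \<chi>01 residue_in[OF N[of k]] by metis
    qed (simp add: \<chi>_def)
    have val: "(cyc (3 ^ k), \<chi>) \<in> valuations ?S ?B"
      unfolding valuations_def using C \<chi> by (rule SigmaI)
    have eval: "ev k (d u) = u (cyc (3 ^ k), \<chi>)" if "u \<in> topspace (Omega ?S ?B)" for u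
      unfolding \<chi>_def by (rule continuous_hom_eq_evaluation[OF hom C _ that]) simp
    have "residue (3 ^ k) (2 * z) = lhs (cyc (3 ^ k), \<chi>)"
      unfolding lhs_def pmul_apply[OF C \<chi>] letter_apply[OF C \<chi>] \<chi>01
      by (simp only: smul_residue[OF N] mult_2)
    also have "\<dots> = ev k (d lhs)" by (rule eval[OF lhs, symmetric])
    also have "\<dots> = ev k (d rhs)"
      using fun_cong[OF equal, of "(cyc (3 ^ k), \<phi> k)"]
      unfolding psi_apply[OF cyc_in_G_nil[OF N] \<phi>] sg_unit_cyc[OF N] ev_def .
    also have "\<dots> = rhs (cyc (3 ^ k), \<chi>)" by (rule eval[OF rhs])
    also have "\<dots> = pow_pow_omega (cyc (3 ^ k)) 2 (residue (3 ^ k) 1)"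
      unfolding rhs_def power_limit_def restrict_apply'[OF val] prod.case \<chi>01 pow_pow_omega_def ..
    also have "\<dots> = residue (3 ^ k) 1"
      by (rule pow_pow_omega_residue_coprime[OF N]) simp_all
    finally show ?thesis by (simp only: residue_eq_iff[OF N])
  qed
  \<comment> \<open>A nonzero integer is divisible only by finitely many powers of \<open>3\<close>.\<close>
  define m where "m = nat \<bar>2 * z - 1\<bar>"
  have m: "int m = \<bar>2 * z - 1\<bar>" by (simp add: m_def)
  have "m > 0" using m by presburger
  have "int (3 ^ m) dvd int m" unfolding m dvd_abs_iff by (rule dvd)
  then have "3 ^ m \<le> m" using \<open>m > 0\<close> unfolding of_nat_dvd_iff by (rule dvd_imp_le)
  moreover have "m < 3 ^ m" by (rule power_gt_expt) simp
  ultimately show False by linarith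
qed

end
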